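(* A group admitting a finite complete rewriting system is algorithmically stackable.
   Context: Finite complete rewriting system. A finite complete rewriting system for a group $G$ consists of a finite set $A$ and a finite set of rules $R\subseteq A^*\times A^*$ (with each $(u,v)\in R$ written $u\to v$) such that, as a monoid, $G$ is presented by $G=\mathrm{Mon}\langle A\mid u=v \text{ whenever } u\to v\in R\rangle$, and the rewritings $xuy\to xvy$ for all $x,y\in A^*$ and $u\to v$ in $R$ satisfy: (1) each $g\in G$ is represented by exactly one irreducible word (i.e. word that cannot be rewritten) over $A$; and (2) the relation on $A^*$ defined by $x>y$ whenever $x\to x_1\to\cdots\to x_n\to y$ is a well-founded strict partial ordering, i.e. there is no infinite chain $w\to x_1\to x_2\to\cdots$ of rewritings. Conventions for stackability. A finite generating set $A$ of a group $G$ is symmetric if it is closed under inversion; for $a\in A$, $a^{-1}\in A$ denotes the inverse letter. Standing assumption for the generating set in the definition of (algorithmically) stackable: no element of $A$ represents the identity of $G$. $\rho:A^*\to G$ is the canonical monoid homomorphism. Let $\Gamma=\Gamma(G,A)$ be the Cayley graph, $\vec E$ its set of directed edges, and $\vec P$ its set of directed edge paths; $\lambda:\vec P\to A^*$ maps each path to the word labeling it. For $g\in G$, $a\in A$, let $e_{g,a}\in\vec E$ be the directed edge with initial vertex $g$, terminal vertex $ga$ and label $a$. The directed edges $e_{g,a}$ and $e_{ga,a^{-1}}$ are viewed as having a single underlying undirected edge. The edges lying on a directed path are taken with the direction in which the path traverses them. Flow function. A flow function associated to a maximal tree $T$ in $\Gamma$ is a function $\Phi:\vec E\to\vec P$ such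 that: (F1) for each $e\in\vec E$, the path $\Phi(e)$ has the same initial and terminal vertices as $e$; (F2d) if the undirected edge underlying $e$ lies in $T$, then $\Phi(e)=e$; (F2r) the transitive closure $<_\Phi$ of the relation $<$ on $\vec E$ defined by "$e'<e$ whenever $e'$ lies on the path $\Phi(e)$ and the undirected edges underlying both $e$ and $e'$ do not lie in $T$" is a well-founded strict partial ordering. A flow function is bounded if there is a constant $k$ such that for all $e\in\vec E$ the path $\Phi(e)$ has length at most $k$. Algorithmically stackable. $G$ is algorithmically stackable if for some finite symmetric generating set $A$ (not required to be the alphabet of a given rewriting system) there is a bounded flow function $\Phi$ on $\Gamma(G,A)$ (associated to some maximal tree) such that the subset $$S_\Phi:=\{(w,a,\lambda(\Phi(e_{\rho(w),a})))\mid w\in A^*,\ a\in A\}$$ of $A^*\times A\times A^*$ is recursive (computable). *)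

theory Defs
  imports
    "HOL-Algebra.Generated_Groups"
    "HOL-Library.Nat_Bijection"
    "Graph_Theory.Digraph_Component"
begin

section \<open>Monoid presentations and finite complete rewriting systems\<close>

inductive_set monoid_congruence :: "'b set \<Rightarrow> ('b list \<times> 'b list) set \<Rightarrow> ('b list \<times> 'b list) set"
  for A :: "'b set" and R :: "('b list \<times> 'b list) set" where
  rule: "(u, v) \<in> R \<Longrightarrow> (u, v) \<in> monoid_congruence A R"
| refl: "w \<in> lists A \<Longrightarrow> (w, w) \<in> monoid_congruence A R"
| sym: "(u, v) \<in> monoid_congruence A R \<Longrightarrow> (v, u) \<in> monoid_congruence A R"
| trans: "(u, v) \<in> monoid_congruence A R \<Longrightarrow> (v, w) \<in> monoid_congruence A R
    \<Longrightarrow> (u, w) \<in> monoid_congruence A R"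
| cong: "(u, v) \<in> monoid_congruence A R \<Longrightarrow> x \<in> lists A \<Longrightarrow> y \<in> lists A
    \<Longrightarrow> (x @ u @ y, x @ v @ y) \<in> monoid_congruence A R"

definition word_class :: "'b set \<Rightarrow> ('b list \<times> 'b list) set \<Rightarrow> 'b list \<Rightarrow> 'b list set" where
  "word_class A R w = monoid_congruence A R `` {w}"

text \<open>The product below does not depend on representatives: the union over all representatives
  is the class of any one of them.\<close>

definition presented_monoid :: "'b set \<Rightarrow> ('b list \<times> 'b list) set \<Rightarrow> 'b list set monoid" where
  "presented_monoid A R =
     \<lparr> carrier = lists A // monoid_congruence A R,
       monoid.mult = (\<lambda>X Y. \<Union>x\<in>X. \<Union>y\<in>Y. word_class A R (x @ y)),
       one = word_class A R [] \<rparr>"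

lemma monoid_congruence_lists:
  assumes "R \<subseteq> lists A \<times> lists A" and "(u, v) \<in> monoid_congruence A R"
  shows "u \<in> lists A \<and> v \<in> lists A"
  using assms(2,1) by (induction rule: monoid_congruence.induct) auto

lemma equiv_monoid_congruence:
  assumes "R \<subseteq> lists A \<times> lists A"
  shows "equiv (lists A) (monoid_congruence A R)"
proof (rule equivI)
  show "monoid_congruence A R \<subseteq> lists A \<times> lists A"
    using monoid_congruence_lists[OF assms] by auto
  show "refl_on (lists A) (monoid_congruence A R)"
    by (auto simp: refl_on_def intro: monoid_congruence.refl)
  show "sym (monoid_congruence A R)"
    by (auto simp: sym_def intro: monoid_congruence.sym)
  show "trans (monoid_congruence A R)"
    by (rule transI) (rule monoid_congruence.trans)
qed

lemma presented_monoid_mult: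
  assumes R: "R \<subseteq> lists A \<times> lists A" and x: "x \<in> lists A" and y: "y \<in> lists A"
  shows "word_class A R x \<otimes>\<^bsub>presented_monoid A R\<^esub> word_class A R y = word_class A R (x @ y)"
proof -
  have "word_class A R (x' @ y') = word_class A R (x @ y)"
    if "x' \<in> word_class A R x" "y' \<in> word_class A R y" for x' y'
  proof -
    have xx: "(x, x') \<in> monoid_congruence A R" and yy: "(y, y') \<in> monoid_congruence A R"
      using that by (auto simp: word_class_def)
    have "(x @ y, x' @ y) \<in> monoid_congruence A R"
      using monoid_congruence.cong[OF xx, of "[]" y] y by simp
    moreover have "(x' @ y, x' @ y') \<in> monoid_congruence A R"
      using monoid_congruence.cong[OF yy, of x' "[]"] monoid_congruence_lists[OF R xx] by simp
    ultimately have "(x @ y, x' @ y') \<in> monoid_congruence A R"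
      by (rule monoid_congruence.trans)
    then show ?thesis
      using equiv_class_eq[OF equiv_monoid_congruence[OF R]] by (simp add: word_class_def)
  qed
  moreover have "x \<in> word_class A R x" "y \<in> word_class A R y"
    using x y by (auto simp: word_class_def intro: monoid_congruence.refl)
  ultimately have "(\<Union>x'\<in>word_class A R x. \<Union>y'\<in>word_class A R y. word_class A R (x' @ y'))
      = word_class A R (x @ y)"
    by blast
  then show ?thesis
    by (simp add: presented_monoid_def)
qed

definition rewrite_step :: "'b set \<Rightarrow> ('b list \<times> 'b list) set \<Rightarrow> ('b list \<times> 'b list) set" where
  "rewrite_step A R =
     {(x @ u @ y, x @ v @ y) | x u v y. x \<in> lists A \<and> y \<in> lists A \<and> (u, v) \<in> R}"

definition irreducible_word :: "'b set \<Rightarrow> ('b list \<times> 'b list) set \<Rightarrow> 'b list \<Rightarrow> bool" where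
  "irreducible_word A R w \<longleftrightarrow> w \<in> lists A \<and> (\<nexists>w'. (w, w') \<in> rewrite_step A R)"

text \<open>The letters are abstract symbols: distinct letters may stand for the same element of the
  group. A word \<open>w\<close> represents \<open>\<phi> (word_class A R w)\<close>, where \<open>\<phi>\<close> is the isomorphism from the
  presented monoid to the group. In the last clause, \<open>wf\<close> of the converse of the transitive
  closure makes the order \<open>x > y\<close> well-founded, hence also irreflexive.\<close>

definition finite_complete_rewriting_system ::
    "('g, 'm) monoid_scheme \<Rightarrow> 'b set \<Rightarrow> ('b list \<times> 'b list) set \<Rightarrow> bool" where
  "finite_complete_rewriting_system G A R \<longleftrightarrow>
     finite A \<and> finite R \<and> R \<subseteq> lists A \<times> lists A \<and>
     (\<exists>\<phi> \<in> iso (presented_monoid A R) G.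
        \<forall>g \<in> carrier G. \<exists>!w. irreducible_word A R w \<and> \<phi> (word_class A R w) = g) \<and>
     wf (((rewrite_step A R)\<^sup>+)\<inverse>)"


section \<open>Recursive sets of tuples of natural numbers\<close>

text \<open>\<open>recursive_fun n f\<close> says that \<open>f\<close>, restricted to lists of length \<open>n\<close>, is a total recursive
  function of \<open>n\<close> arguments; values on lists of other lengths are irrelevant. Minimisation is
  applied to regular functions only, which still yields all total recursive functions
  by Kleene's normal form theorem.\<close>

inductive recursive_fun :: "nat \<Rightarrow> (nat list \<Rightarrow> nat) \<Rightarrow> bool" where
  zero: "recursive_fun n (\<lambda>_. 0)"
| succ: "recursive_fun 1 (\<lambda>xs. Suc (xs ! 0))"
| proj: "i < n \<Longrightarrow> recursive_fun n (\<lambda>xs. xs ! i)"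
| comp: "recursive_fun (length gs) f \<Longrightarrow> (\<And>g. g \<in> set gs \<Longrightarrow> recursive_fun n g)
    \<Longrightarrow> recursive_fun n (\<lambda>xs. f (map (\<lambda>g. g xs) gs))"
| prim_rec: "recursive_fun n f \<Longrightarrow> recursive_fun (Suc (Suc n)) g
    \<Longrightarrow> recursive_fun (Suc n)
          (\<lambda>xs. rec_nat (f (tl xs)) (\<lambda>k r. g (k # r # tl xs)) (hd xs))"
| minimisation: "recursive_fun (Suc n) f \<Longrightarrow> (\<And>xs. length xs = n \<Longrightarrow> \<exists>k. f (k # xs) = 0)
    \<Longrightarrow> recursive_fun n (\<lambda>xs. LEAST k. f (k # xs) = 0)"

definition recursive_set :: "nat \<Rightarrow> nat list set \<Rightarrow> bool" where
  "recursive_set n S \<longleftrightarrow> S \<subseteq> {xs. length xs = n} \<and>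
     (\<exists>f. recursive_fun n f \<and> (\<forall>xs. length xs = n \<longrightarrow> f xs = (if xs \<in> S then 1 else 0)))"

text \<open>Subsets of \<open>A\<^sup>* \<times> A \<times> A\<^sup>*\<close> for finite \<open>A\<close> are coded by numbering the letters and coding words
  with \<open>list_encode\<close>. Since \<open>A\<close> is finite, the choice of the numbering \<open>c\<close> does not matter.\<close>

definition recursive_word_set :: "'a set \<Rightarrow> ('a list \<times> 'a \<times> 'a list) set \<Rightarrow> bool" where
  "recursive_word_set A S \<longleftrightarrow> S \<subseteq> lists A \<times> A \<times> lists A \<and>
     (\<exists>c :: 'a \<Rightarrow> nat. inj_on c A \<and>
        recursive_set 3
          ((\<lambda>(w, a, v). [list_encode (map c w), c a, list_encode (map c v)]) ` S))"


section \<open>Cayley graphs and flow functions\<close>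

definition symmetric_generating_set :: "('g, 'm) monoid_scheme \<Rightarrow> 'g set \<Rightarrow> bool" where
  "symmetric_generating_set G A \<longleftrightarrow>
     A \<subseteq> carrier G \<and> generate G A = carrier G \<and> (\<forall>a\<in>A. inv\<^bsub>G\<^esub> a \<in> A)"

definition word_value :: "('g, 'm) monoid_scheme \<Rightarrow> 'g list \<Rightarrow> 'g" where
  "word_value G w = foldr (\<lambda>a g. a \<otimes>\<^bsub>G\<^esub> g) w \<one>\<^bsub>G\<^esub>"

text \<open>The pair \<open>(g, a)\<close> is the directed edge from \<open>g\<close> to \<open>ga\<close> labelled \<open>a\<close>. A directed path from \<open>g\<close>
  to \<open>h\<close> is a list \<open>p\<close> of such edges with \<open>awalk g p h\<close>; its label is \<open>map snd p\<close>.\<close>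

definition cayley_graph :: "('g, 'm) monoid_scheme \<Rightarrow> 'g set \<Rightarrow> ('g, 'g \<times> 'g) pre_digraph" where
  "cayley_graph G A =
     \<lparr> verts = carrier G, arcs = carrier G \<times> A,
       tail = fst, head = (\<lambda>(g, a). g \<otimes>\<^bsub>G\<^esub> a) \<rparr>"

fun reverse_edge :: "('g, 'm) monoid_scheme \<Rightarrow> 'g \<times> 'g \<Rightarrow> 'g \<times> 'g" where
  "reverse_edge G (g, a) = (g \<otimes>\<^bsub>G\<^esub> a, inv\<^bsub>G\<^esub> a)"

definition path_label :: "('g \<times> 'g) list \<Rightarrow> 'g list" where
  "path_label p = map snd p"

text \<open>An undirected subgraph is represented by a directed one whose edge set is closed under
  reversal, so \<open>e \<in> arcs T\<close> means that the undirected edge underlying \<open>e\<close> lies in \<open>T\<close>. Cycles of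
  length 2 in \<open>T\<close> merely traverse one undirected edge back and forth: a Cayley graph for
  \<open>A \<subseteq> carrier G\<close> with \<open>\<one> \<notin> A\<close> has neither loops nor parallel edges. Hence the genuine
  undirected cycles are those of length at least 3.\<close>

definition undirected_tree ::
    "('g, 'm) monoid_scheme \<Rightarrow> ('g, 'g \<times> 'g) pre_digraph \<Rightarrow> bool" where
  "undirected_tree G T \<longleftrightarrow>
     (\<forall>e \<in> arcs T. reverse_edge G e \<in> arcs T) \<and>
     connected T \<and> (\<nexists>p. pre_digraph.cycle T p \<and> 3 \<le> length p)"

definition maximal_tree ::
    "('g, 'm) monoid_scheme \<Rightarrow> 'g set \<Rightarrow> ('g, 'g \<times> 'g) pre_digraph \<Rightarrow> bool" where
  "maximal_tree G A T \<longleftrightarrow> pre_digraph.max_subgraph (cayley_graph G A) (undirected_tree G) T"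

definition flow_less ::
    "('g, 'm) monoid_scheme \<Rightarrow> 'g set \<Rightarrow> ('g, 'g \<times> 'g) pre_digraph
      \<Rightarrow> ('g \<times> 'g \<Rightarrow> ('g \<times> 'g) list) \<Rightarrow> (('g \<times> 'g) \<times> ('g \<times> 'g)) set" where
  "flow_less G A T \<Phi> =
     {(e', e). e \<in> arcs (cayley_graph G A) \<and> e' \<in> set (\<Phi> e) \<and> e \<notin> arcs T \<and> e' \<notin> arcs T}"

definition flow_function ::
    "('g, 'm) monoid_scheme \<Rightarrow> 'g set \<Rightarrow> ('g, 'g \<times> 'g) pre_digraph
      \<Rightarrow> ('g \<times> 'g \<Rightarrow> ('g \<times> 'g) list) \<Rightarrow> bool" where
  "flow_function G A T \<Phi> \<longleftrightarrow>
     (\<forall>e \<in> arcs (cayley_graph G A).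
        pre_digraph.awalk (cayley_graph G A)
          (tail (cayley_graph G A) e) (\<Phi> e) (head (cayley_graph G A) e)) \<and>
     (\<forall>e \<in> arcs (cayley_graph G A). e \<in> arcs T \<longrightarrow> \<Phi> e = [e]) \<and>
     wf ((flow_less G A T \<Phi>)\<^sup>+)"

definition bounded_flow ::
    "('g, 'm) monoid_scheme \<Rightarrow> 'g set \<Rightarrow> ('g \<times> 'g \<Rightarrow> ('g \<times> 'g) list) \<Rightarrow> bool" where
  "bounded_flow G A \<Phi> \<longleftrightarrow> (\<exists>k. \<forall>e \<in> arcs (cayley_graph G A). length (\<Phi> e) \<le> k)"

definition flow_graph ::
    "('g, 'm) monoid_scheme \<Rightarrow> 'g set \<Rightarrow> ('g \<times> 'g \<Rightarrow> ('g \<times> 'g) list)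
      \<Rightarrow> ('g list \<times> 'g \<times> 'g list) set" where
  "flow_graph G A \<Phi> =
     {(w, a, path_label (\<Phi> (word_value G w, a))) | w a. w \<in> lists A \<and> a \<in> A}"

definition algorithmically_stackable :: "('g, 'm) monoid_scheme \<Rightarrow> bool" where
  "algorithmically_stackable G \<longleftrightarrow>
     (\<exists>A. finite A \<and> symmetric_generating_set G A \<and> \<one>\<^bsub>G\<^esub> \<notin> A \<and>
        (\<exists>T \<Phi>. maximal_tree G A T \<and> flow_function G A T \<Phi> \<and> bounded_flow G A \<Phi> \<and>
           recursive_word_set A (flow_graph G A \<Phi>)))"

end

theory Submission
  imports Defs "HOL-Library.Sublist"
begin

text \<open>
  Suppose first that the letters of the rewriting system are themselves the elements of a symmetric
  generating set \<open>A\<close> without \<open>1\<close> (locale \<open>group_rewriting\<close>), and write \<open>nf g\<close> for the irreducible word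
  that represents \<open>g\<close>. Prefixes of irreducible words are irreducible, so the normal forms
  span a maximal tree of the Cayley graph. If the edge \<open>(g, a)\<close> is not in the tree, then the word \<open>nf g a\<close>
  is reducible and equal to \<open>x u a\<close> for some rule \<open>u a \<rightarrow> v\<close>. The flow sends the edge back along \<open>u\<close> to \<open>x\<close>
  and then along \<open>v\<close>. There are finitely many rules, so these paths have bounded length.

  To see that the flow is well-founded, attach the word \<open>nf g a\<close> to the edge \<open>(g, a)\<close>. The way back along
  \<open>u\<close> is in the tree. If \<open>v = p c q\<close>, then the edge labelled \<open>c\<close> after it starts at \<open>h = x p\<close>, and
  \<open>nf g a = x u a\<close> rewrites to \<open>x p c q\<close> and then to \<open>nf h c q\<close>. So the word \<open>nf h c\<close> of the new edge is a
  prefix of a word that arises from the word of the old edge by at least one rewriting. Such steps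
  cannot go on forever (\<open>wf_rewrite_to_prefix\<close>, \<open>flow_edge_smaller\<close>).

  The label of the path of an edge \<open>(g, a)\<close> depends only on \<open>a\<close> and on a bounded number of last letters of
  \<open>nf g\<close>. It is therefore computable as soon as normal forms are, and these are computed by a machine
  that rewrites with a stack (\<open>reduce_step_reaches_nf\<close>, \<open>recursive_flow_graph\<close>).

  In general the letters are abstract symbols, which may be trivial in the group, equal to one
  another there, or without an inverse letter. The reducible letters do not occur in
  irreducible words and are discarded; the other ones are pairwise different and nontrivial in the
  group. The missing inverses are added as new letters, each with a rule that replaces it by the
  normal form of its value. With right-hand sides brought to normal form the result is again
  a complete rewriting system, to which the first part applies (locale \<open>complete_presentation\<close>).
\<close>

section \<open>Total recursive functions\<close>

text \<open>The predicate \<open>recursive_fun n\<close> pins down a function on lists of every length, so it is not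
  closed under changing the meaningless values on lists of length other than \<open>n\<close>. Its closure under
  such changes is, and this makes equational reasoning inside the functions possible.\<close>

definition computable :: "nat \<Rightarrow> (nat list \<Rightarrow> nat) \<Rightarrow> bool" where
  "computable n f \<longleftrightarrow> (\<exists>f'. recursive_fun n f' \<and> (\<forall>xs. length xs = n \<longrightarrow> f' xs = f xs))"

definition decidable :: "nat \<Rightarrow> (nat list \<Rightarrow> bool) \<Rightarrow> bool" where
  "decidable n P \<longleftrightarrow> computable n (\<lambda>xs. of_bool (P xs))"

lemma computable_cong:
  assumes "computable n f" and "\<And>xs. length xs = n \<Longrightarrow> f xs = g xs"
  shows "computable n g"
  using assms unfolding computable_def by fastforce

lemma decidable_cong:
  assumes "decidable n P" and "\<And>xs. length xs = n \<Longrightarrow> P xs = Q xs"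
  shows "decidable n Q"
  using assms unfolding decidable_def by (auto elim!: computable_cong)

lemma computable_comp:
  assumes f: "computable (length gs) f" and gs: "\<And>g. g \<in> set gs \<Longrightarrow> computable n g"
  shows "computable n (\<lambda>xs. f (map (\<lambda>g. g xs) gs))"
proof -
  obtain f' where f': "recursive_fun (length gs) f'" "\<And>xs. length xs = length gs \<Longrightarrow> f' xs = f xs"
    using f unfolding computable_def by blast
  have "\<forall>g. \<exists>g'. g \<in> set gs \<longrightarrow> recursive_fun n g' \<and> (\<forall>xs. length xs = n \<longrightarrow> g' xs = g xs)"
    using gs unfolding computable_def by blast
  then obtain r where r: "\<And>g. g \<in> set gs \<Longrightarrow> recursive_fun n (r g)"
      "\<And>g xs. g \<in> set gs \<Longrightarrow> length xs = n \<Longrightarrow> r g xs = g xs"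
    by metis
  have "recursive_fun n (\<lambda>xs. f' (map (\<lambda>g. g xs) (map r gs)))"
    by (rule recursive_fun.comp) (auto simp: f' r)
  moreover have "f' (map (\<lambda>g. g xs) (map r gs)) = f (map (\<lambda>g. g xs) gs)" if "length xs = n" for xs
  proof -
    have "map (\<lambda>g. g xs) (map r gs) = map (\<lambda>g. g xs) gs"
      using r(2) that by simp
    then show ?thesis using f'(2)[of "map (\<lambda>g. g xs) (map r gs)"] by (simp del: map_map)
  qed
  ultimately show ?thesis unfolding computable_def by blast
qed

lemma computable_nth: "i < n \<Longrightarrow> computable n (\<lambda>xs. xs ! i)"
  unfolding computable_def using recursive_fun.proj by blast

lemma computable_reindex:
  assumes f: "computable (length is) f" and "\<And>i. i \<in> set is \<Longrightarrow> i < n"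
  shows "computable n (\<lambda>xs. f (map ((!) xs) is))"
proof -
  have "computable n (\<lambda>xs. f (map (\<lambda>g. g xs) (map (\<lambda>i xs. xs ! i) is)))"
    by (rule computable_comp) (auto simp: f intro: computable_nth assms(2))
  then show ?thesis by (simp add: comp_def)
qed

lemma computable_drop2:
  assumes "computable n f"
  shows "computable (Suc (Suc n)) (\<lambda>ys. f (drop 2 ys))"
proof (rule computable_cong)
  show "computable (Suc (Suc n)) (\<lambda>ys. f (map ((!) ys) [2..<n+2]))"
    by (rule computable_reindex) (use assms in \<open>simp_all del: upt_Suc\<close>)
  show "f (map ((!) ys) [2..<n+2]) = f (drop 2 ys)" if "length ys = Suc (Suc n)" for ys
    using that by (metis add_2_eq_Suc' drop_upt map_nth drop_map add_0)
qed

lemma computable_unary: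
  assumes "computable 1 (\<lambda>ys. F (ys ! 0))" and "computable n g"
  shows "computable n (\<lambda>xs. F (g xs))"
  using computable_comp[of "[g]" "\<lambda>ys. F (ys ! 0)" n] assms by simp

lemma computable_Suc: "computable n g \<Longrightarrow> computable n (\<lambda>xs. Suc (g xs))"
  by (rule computable_unary) (use recursive_fun.succ in \<open>auto simp: computable_def\<close>)

lemma computable_const: "computable n (\<lambda>_. c)"
proof (induction c)
  case 0
  then show ?case unfolding computable_def using recursive_fun.zero by blast
qed (rule computable_Suc)

text \<open>The function \<open>g\<close> finds the counter and the value so far in front of the arguments.\<close>

lemma computable_rec:
  assumes f: "computable n f" and g: "computable (Suc (Suc n)) g" and b: "computable n b"
  shows "computable n (\<lambda>xs. rec_nat (f xs) (\<lambda>k r. g (k # r # xs)) (b xs))"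
proof -
  obtain f' g' where f': "recursive_fun n f'" "\<And>xs. length xs = n \<Longrightarrow> f' xs = f xs"
    and g': "recursive_fun (Suc (Suc n)) g'" "\<And>xs. length xs = Suc (Suc n) \<Longrightarrow> g' xs = g xs"
    using f g unfolding computable_def by blast
  define h where "h = (\<lambda>xs. rec_nat (f' (tl xs)) (\<lambda>k r. g' (k # r # tl xs)) (hd xs))"
  have "computable (Suc n) h"
    unfolding computable_def h_def using recursive_fun.prim_rec[OF f'(1) g'(1)] by blast
  then have "computable n (\<lambda>xs. h (map (\<lambda>g. g xs) (b # map (\<lambda>i xs. xs ! i) [0..<n])))"
    by (intro computable_comp) (auto simp: b intro: computable_nth)
  then show ?thesis
  proof (rule computable_cong)
    fix xs :: "nat list" assume xs: "length xs = n"
    have eq: "map (\<lambda>g. g xs) (map (\<lambda>i xs. xs ! i) [0..<n]) = xs"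
      using xs map_nth[of xs] by (simp add: comp_def)
    have "rec_nat (f' xs) (\<lambda>k r. g' (k # r # xs)) m = rec_nat (f xs) (\<lambda>k r. g (k # r # xs)) m" for m
      by (induction m) (simp_all add: f' g' xs)
    then show "h (map (\<lambda>g. g xs) (b # map (\<lambda>i xs. xs ! i) [0..<n]))
        = rec_nat (f xs) (\<lambda>k r. g (k # r # xs)) (b xs)"
      unfolding h_def list.map eq by simp
  qed
qed

lemma computable_funpow:
  assumes F: "computable 1 (\<lambda>ys. F (ys ! 0))" and b: "computable n b" and z: "computable n z"
  shows "computable n (\<lambda>xs. (F ^^ b xs) (z xs))"
proof -
  have "computable (Suc (Suc n)) (\<lambda>ys. F (ys ! 1))"
    by (rule computable_unary[OF F]) (simp add: computable_nth)
  from computable_rec[OF z this b]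
  have "computable n (\<lambda>xs. rec_nat (z xs) (\<lambda>k. F) (b xs))"
    by simp
  moreover have "rec_nat x (\<lambda>k. F) m = (F ^^ m) x" for x m
    by (induction m) auto
  ultimately show ?thesis by simp
qed

lemma computable_if:
  assumes P: "decidable n P" and f: "computable n f" and g: "computable n g"
  shows "computable n (\<lambda>xs. if P xs then f xs else g xs)"
  by (rule computable_cong[OF computable_rec[OF g computable_drop2[OF f] P[unfolded decidable_def]]])
    auto

lemma computable_diff_one: "computable n f \<Longrightarrow> computable n (\<lambda>xs. f xs - 1)"
  by (rule computable_cong[OF computable_rec[OF computable_const[of _ 0] computable_nth[of 0]]])
    (auto split: nat_diff_split simp: gr0_conv_Suc)

lemma computable_add:
  assumes "computable n f" and "computable n g"
  shows "computable n (\<lambda>xs. f xs + g xs)"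
proof -
  have "rec_nat x (\<lambda>k r. Suc r) m = x + m" for x m :: nat
    by (induction m) auto
  then show ?thesis
    using computable_rec[OF assms(1) computable_Suc[OF computable_nth[of 1]] assms(2)] by simp
qed

lemma computable_diff:
  assumes "computable n f" and "computable n g"
  shows "computable n (\<lambda>xs. f xs - g xs)"
proof -
  have "rec_nat x (\<lambda>k r. r - 1) m = x - m" for x m :: nat
    by (induction m) auto
  then show ?thesis
    using computable_rec[OF assms(1) computable_diff_one[OF computable_nth[of 1]] assms(2)] by simp
qed

lemma decidable_eq_0:
  assumes "computable n f"
  shows "decidable n (\<lambda>xs. f xs = 0)"
proof -
  have "rec_nat (Suc 0) (\<lambda>k r. 0) m = of_bool (m = 0)" for m :: nat
    by (cases m) auto
  then show ?thesis
    using computable_rec[OF computable_const[of n 1] computable_const[of _ 0] assms]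
    unfolding decidable_def by simp
qed

lemma decidable_le:
  "computable n f \<Longrightarrow> computable n g \<Longrightarrow> decidable n (\<lambda>xs. f xs \<le> g xs)"
  by (rule decidable_cong[OF decidable_eq_0[OF computable_diff]]) auto

lemma decidable_conj:
  assumes "decidable n P" and "decidable n Q"
  shows "decidable n (\<lambda>xs. P xs \<and> Q xs)"
  unfolding decidable_def
  by (rule computable_cong[OF computable_if[OF assms(1) assms(2)[unfolded decidable_def]
    computable_const[of n 0]]]) auto

lemma decidable_not:
  assumes "decidable n P"
  shows "decidable n (\<lambda>xs. \<not> P xs)"
  unfolding decidable_def
  by (rule computable_cong[OF computable_if[OF assms computable_const[of n 0]
    computable_const[of n 1]]]) auto

lemma decidable_disj:
  assumes "decidable n P" and "decidable n Q"
  shows "decidable n (\<lambda>xs. P xs \<or> Q xs)"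
  using decidable_not[OF decidable_conj[OF decidable_not[OF assms(1)] decidable_not[OF assms(2)]]]
  by simp

lemma decidable_eq:
  "computable n f \<Longrightarrow> computable n g \<Longrightarrow> decidable n (\<lambda>xs. f xs = g xs)"
  by (rule decidable_cong[OF decidable_conj[OF decidable_le[of n f g] decidable_le[of n g f]]]) auto

lemma decidable_Bex_finite:
  assumes "finite S" and "\<And>a. a \<in> S \<Longrightarrow> decidable n (P a)"
  shows "decidable n (\<lambda>xs. \<exists>a\<in>S. P a xs)"
  using assms
proof (induction S rule: finite_induct)
  case empty
  show ?case by (simp add: decidable_def computable_const)
qed (simp add: decidable_disj)

lemma computable_Least:
  assumes P: "decidable (Suc n) P" and ex: "\<And>xs. length xs = n \<Longrightarrow> \<exists>k. P (k # xs)"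
  shows "computable n (\<lambda>xs. LEAST k. P (k # xs))"
proof -
  obtain f where f: "recursive_fun (Suc n) f"
      "\<And>xs. length xs = Suc n \<Longrightarrow> f xs = of_bool (\<not> P xs)"
    using decidable_not[OF P] unfolding decidable_def computable_def by blast
  have "recursive_fun n (\<lambda>xs. LEAST k. f (k # xs) = 0)"
    by (rule recursive_fun.minimisation) (use f ex in auto)
  then show ?thesis
    unfolding computable_def using f(2) by (intro exI conjI) auto
qed

section \<open>Computing with coded pairs and lists\<close>

lemma computable_triangle:
  assumes "computable n f"
  shows "computable n (\<lambda>xs. triangle (f xs))"
proof -
  have "rec_nat 0 (\<lambda>k r. r + Suc k) m = triangle m" for m
    by (induction m) auto
  then show ?thesis
    using computable_rec[OF computable_const[of n 0]
        computable_add[OF computable_nth[of 1] computable_Suc[OF computable_nth[of 0]]] assms]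
    by simp
qed

lemma computable_prod_encode:
  "computable n f \<Longrightarrow> computable n g \<Longrightarrow> computable n (\<lambda>xs. prod_encode (f xs, g xs))"
  unfolding prod_encode_def by (simp add: computable_add computable_triangle)

text \<open>The diagonal \<open>a + b\<close> of a coded pair is the last one whose triangle number does not exceed
  the code.\<close>

lemma prod_decode_by_search:
  "prod_decode m = (let s = LEAST s. m < triangle (Suc s) in (m - triangle s, s - (m - triangle s)))"
proof -
  obtain a b where ab: "prod_decode m = (a, b)" by fastforce
  then have m: "m = triangle (a + b) + a"
    using prod_decode_inverse[of m] by (simp add: prod_encode_def)
  have mono: "s \<le> t \<Longrightarrow> triangle s \<le> triangle t" for s t
    by (induction t) (auto simp: le_Suc_eq)
  have "(LEAST s. m < triangle (Suc s)) = a + b"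
  proof (rule Least_equality)
    show "a + b \<le> s" if "m < triangle (Suc s)" for s
      using that mono[of "Suc s" "a + b"] m by linarith
  qed (simp add: m)
  then show ?thesis using ab m by (simp add: Let_def)
qed

lemma computable_prod_decode:
  assumes "computable n f"
  shows "computable n (\<lambda>xs. fst (prod_decode (f xs)))"
    and "computable n (\<lambda>xs. snd (prod_decode (f xs)))"
proof -
  have D: "decidable 2 (\<lambda>ys. \<not> triangle (Suc (ys ! 0)) \<le> ys ! 1)"
    by (intro decidable_not decidable_le computable_triangle computable_Suc computable_nth) auto
  have "computable 1 (\<lambda>xs. LEAST s. \<not> triangle (Suc ((s # xs) ! 0)) \<le> (s # xs) ! 1)"
  proof (rule computable_Least[where P = "\<lambda>ys. \<not> triangle (Suc (ys ! 0)) \<le> ys ! 1"])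
    show "\<exists>s. \<not> triangle (Suc ((s # xs) ! 0)) \<le> (s # xs) ! 1" for xs
      by (rule exI[of _ "xs ! 0"]) (simp add: triangle_def)
  qed (use D in \<open>simp add: numeral_2_eq_2\<close>)
  then have S: "computable 1 (\<lambda>xs. LEAST s. xs ! 0 < triangle (Suc s))"
    by (simp add: not_le)
  have "computable 1 (\<lambda>xs. fst (prod_decode (xs ! 0)))"
    unfolding prod_decode_by_search Let_def fst_conv
    by (intro computable_diff computable_triangle computable_nth S) simp
  then show "computable n (\<lambda>xs. fst (prod_decode (f xs)))"
    by (rule computable_unary) (rule assms)
  have "computable 1 (\<lambda>xs. snd (prod_decode (xs ! 0)))"
    unfolding prod_decode_by_search Let_def snd_conv
    by (intro computable_diff computable_triangle computable_nth S) simp_all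
  then show "computable n (\<lambda>xs. snd (prod_decode (f xs)))"
    by (rule computable_unary) (rule assms)
qed

definition computable_list :: "nat \<Rightarrow> (nat list \<Rightarrow> nat list) \<Rightarrow> bool" where
  "computable_list n f \<longleftrightarrow> computable n (\<lambda>xs. list_encode (f xs))"

lemma computable_list_const: "computable_list n (\<lambda>_. l)"
  by (simp add: computable_list_def computable_const)

lemma computable_list_Cons:
  "computable n f \<Longrightarrow> computable_list n g \<Longrightarrow> computable_list n (\<lambda>xs. f xs # g xs)"
  by (simp add: computable_list_def computable_Suc computable_prod_encode)

lemma computable_list_append_const:
  "computable_list n g \<Longrightarrow> computable_list n (\<lambda>xs. l @ g xs)"
proof (induction l)
  case (Cons a l)
  then show ?case using computable_list_Cons[OF computable_const[of n a]] by simp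
qed simp

lemma computable_list_tl:
  assumes "computable_list n f"
  shows "computable_list n (\<lambda>xs. tl (f xs))"
proof -
  have "list_encode (tl l) = snd (prod_decode (list_encode l - 1))" for l
  proof (cases l)
    case Nil
    have "prod_decode 0 = (0, 0)" by (simp add: prod_decode_def prod_decode_aux.simps)
    then show ?thesis using Nil by simp
  qed simp
  then show ?thesis
    using computable_prod_decode(2)[OF computable_diff_one[OF assms[unfolded computable_list_def]]]
    by (simp add: computable_list_def)
qed

lemma computable_list_drop:
  assumes "computable_list n f"
  shows "computable_list n (\<lambda>xs. drop k (f xs))"
  using assms
proof (induction k)
  case (Suc k)
  then show ?case using computable_list_tl[of n "\<lambda>xs. drop k (f xs)"] by (simp add: drop_Suc tl_drop)
qed simp

lemma decidable_list_eq:
  assumes "computable_list n f" and "computable_list n g"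
  shows "decidable n (\<lambda>xs. f xs = g xs)"
  using decidable_eq[OF assms[unfolded computable_list_def]] by (simp add: list_encode_eq)

text \<open>The head of the empty list is unspecified, hence 0 is returned for it.\<close>

lemma computable_head:
  assumes "computable_list n f"
  shows "computable n (\<lambda>xs. if f xs = [] then 0 else hd (f xs))"
proof -
  have "(if l = [] then 0 else hd l) = fst (prod_decode (list_encode l - 1))" for l
  proof (cases l)
    case Nil
    have "prod_decode 0 = (0, 0)" by (simp add: prod_decode_def prod_decode_aux.simps)
    then show ?thesis using Nil by simp
  qed simp
  then show ?thesis
    using computable_prod_decode(1)[OF computable_diff_one[OF assms[unfolded computable_list_def]]]
    by (simp add: computable_list_def)
qed

lemma decidable_head_eq:
  assumes "computable_list n f" and "computable n g"
  shows "decidable n (\<lambda>xs. f xs \<noteq> [] \<and> hd (f xs) = g xs)"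
  by (rule decidable_cong[OF decidable_conj[OF
        decidable_not[OF decidable_list_eq[OF assms(1) computable_list_const[of n "[]"]]]
        decidable_eq[OF computable_head[OF assms(1)] assms(2)]]]) auto

lemma decidable_prefix:
  assumes "computable_list n f"
  shows "decidable n (\<lambda>xs. prefix p (f xs))"
  using assms
proof (induction p arbitrary: f)
  case Nil
  show ?case by (simp add: decidable_def computable_const)
next
  case (Cons a p)
  have *: "prefix (a # p) l \<longleftrightarrow> (l \<noteq> [] \<and> hd l = a) \<and> prefix p (tl l)" for l
    by (cases l) auto
  show ?case
    unfolding *
    by (rule decidable_conj[OF decidable_head_eq[OF Cons.prems computable_const]
          Cons.IH[OF computable_list_tl[OF Cons.prems]]])
qed

lemma computable_list_if:
  assumes "decidable n P" and "computable_list n f" and "computable_list n g"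
  shows "computable_list n (\<lambda>xs. if P xs then f xs else g xs)"
  using computable_if[OF assms(1) assms(2,3)[unfolded computable_list_def]]
  unfolding computable_list_def by (simp add: if_distrib)

text \<open>The list that is searched is fixed, so the search is a nested case distinction.\<close>

lemma computable_case_find:
  assumes "\<And>r. r \<in> set rs \<Longrightarrow> decidable n (P r)" and "computable n e"
    and "\<And>r. r \<in> set rs \<Longrightarrow> computable n (f r)"
  shows "computable n (\<lambda>xs. case find (\<lambda>r. P r xs) rs of None \<Rightarrow> e xs | Some r \<Rightarrow> f r xs)"
  using assms
proof (induction rs)
  case (Cons r rs)
  have "computable n (\<lambda>xs. if P r xs then f r xs
      else case find (\<lambda>r. P r xs) rs of None \<Rightarrow> e xs | Some r \<Rightarrow> f r xs)"
  proof (rule computable_if)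
    show "computable n (\<lambda>xs. case find (\<lambda>r. P r xs) rs of None \<Rightarrow> e xs | Some r \<Rightarrow> f r xs)"
      by (rule Cons.IH) (use Cons.prems in simp_all)
  qed (use Cons.prems in simp_all)
  then show ?case by (rule computable_cong) simp
qed simp

section \<open>Terminating word rewriting\<close>

lemma rewrite_step_context:
  assumes "(w, w') \<in> rewrite_step A R" and "x \<in> lists A" and "y \<in> lists A"
  shows "(x @ w @ y, x @ w' @ y) \<in> rewrite_step A R"
proof -
  obtain p u v q where "w = p @ u @ q" "w' = p @ v @ q" "p \<in> lists A" "q \<in> lists A" "(u, v) \<in> R"
    using assms(1) by (auto simp: rewrite_step_def)
  then show ?thesis
    using assms(2,3) unfolding rewrite_step_def
    by (intro CollectI exI[of _ "x @ p"] exI[of _ u] exI[of _ v] exI[of _ "q @ y"]) auto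
qed

lemma rewrite_steps_context:
  assumes "x \<in> lists A" and "y \<in> lists A"
  shows "(w, w') \<in> (rewrite_step A R)\<^sup>* \<Longrightarrow> (x @ w @ y, x @ w' @ y) \<in> (rewrite_step A R)\<^sup>*"
    and "(w, w') \<in> (rewrite_step A R)\<^sup>+ \<Longrightarrow> (x @ w @ y, x @ w' @ y) \<in> (rewrite_step A R)\<^sup>+"
proof -
  show "(x @ w @ y, x @ w' @ y) \<in> (rewrite_step A R)\<^sup>*" if "(w, w') \<in> (rewrite_step A R)\<^sup>*"
    using that
    by induction (auto intro: rtrancl_into_rtrancl rewrite_step_context[OF _ assms])
  show "(x @ w @ y, x @ w' @ y) \<in> (rewrite_step A R)\<^sup>+" if "(w, w') \<in> (rewrite_step A R)\<^sup>+"
    using that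
    by induction (auto intro: trancl_into_trancl rewrite_step_context[OF _ assms])
qed

lemma rewrite_step_rule:
  "(u, v) \<in> R \<Longrightarrow> x \<in> lists A \<Longrightarrow> y \<in> lists A \<Longrightarrow> (x @ u @ y, x @ v @ y) \<in> rewrite_step A R"
  by (auto simp: rewrite_step_def)

lemma irreducible_factor:
  assumes "irreducible_word A R (x @ w @ y)"
  shows "irreducible_word A R w"
  using assms rewrite_step_context[of w _ A R x y] unfolding irreducible_word_def by auto

text \<open>A left-hand side that avoids the last letter would already occur in \<open>w\<close>.\<close>

lemma reducible_last_letter:
  assumes "irreducible_word A R w" and "a \<in> A" and "\<not> irreducible_word A R (w @ [a])"
  obtains u v where "(u, v) \<in> R" and "suffix u (w @ [a])"
proof -
  have w: "w \<in> lists A" using assms(1) by (simp add: irreducible_word_def)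
  then obtain x u v y where *: "w @ [a] = x @ u @ y" "x \<in> lists A" "y \<in> lists A" "(u, v) \<in> R"
    using assms(2,3) by (auto simp: irreducible_word_def rewrite_step_def)
  show thesis
  proof (cases y rule: rev_cases)
    case Nil
    then show thesis using * that by (auto simp: suffix_def)
  next
    case (snoc y' b)
    then have "w = x @ u @ y'" using *(1) by simp
    moreover have "y' \<in> lists A" using *(3) snoc by simp
    ultimately have "(w, x @ v @ y') \<in> rewrite_step A R"
      using rewrite_step_rule[OF *(4,2)] by simp
    then show thesis using assms(1) by (simp add: irreducible_word_def)
  qed
qed

text \<open>A rule with empty left-hand side would apply to every word.\<close>

lemma terminating_lhs_nonempty:
  assumes "R \<subseteq> lists A \<times> lists A" and "wf ((rewrite_step A R)\<inverse>)"
  shows "([], v) \<notin> R"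
proof
  assume r: "([], v) \<in> R"
  obtain w where "w \<in> lists A" and min: "\<And>w'. (w, w') \<in> rewrite_step A R \<Longrightarrow> w' \<notin> lists A"
    using wfE_min[OF assms(2), of "[]" "lists A"] by auto
  then have "(w, v @ w) \<in> rewrite_step A R"
    using rewrite_step_rule[OF r, of "[]" A w] by simp
  moreover have "v \<in> lists A" using r assms(1) by auto
  ultimately show False using min[of "v @ w"] \<open>w \<in> lists A\<close> by simp
qed

lemma terminating_Nil_irreducible:
  assumes "R \<subseteq> lists A \<times> lists A" and "wf ((rewrite_step A R)\<inverse>)"
  shows "irreducible_word A R []"
  using terminating_lhs_nonempty[OF assms] by (auto simp: irreducible_word_def rewrite_step_def)

lemma rewrite_step_in_lists:
  "R \<subseteq> lists A \<times> lists A \<Longrightarrow> (w, w') \<in> rewrite_step A R \<Longrightarrow> w' \<in> lists A"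
  unfolding rewrite_step_def by fastforce

lemma terminating_reaches_irreducible:
  assumes R: "R \<subseteq> lists A \<times> lists A" and wf: "wf ((rewrite_step A R)\<inverse>)" and "w \<in> lists A"
  obtains w' where "(w, w') \<in> (rewrite_step A R)\<^sup>*" and "irreducible_word A R w'"
proof -
  have "w \<in> lists A \<Longrightarrow> \<exists>w'. (w, w') \<in> (rewrite_step A R)\<^sup>* \<and> irreducible_word A R w'" for w
  proof (induction w rule: wf_induct_rule[OF wf])
    case (1 w)
    show ?case
    proof (cases "irreducible_word A R w")
      case False
      then obtain z where z: "(w, z) \<in> rewrite_step A R"
        using 1(2) by (auto simp: irreducible_word_def)
      then show ?thesis
        using 1(1)[of z] rewrite_step_in_lists[OF R z] by (meson converse_rtrancl_into_rtrancl converseI)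
    qed auto
  qed
  then show thesis using that assms(3) by blast
qed

text \<open>Passing to prefixes between rewriting steps preserves termination: an infinite chain of
  such steps would lift to an infinite rewriting of the first word, as the discarded suffixes can
  be carried along.\<close>

lemma wf_rewrite_to_prefix:
  assumes R: "R \<subseteq> lists A \<times> lists A" and wf: "wf ((rewrite_step A R)\<inverse>)"
  shows "wf {(p, w). \<exists>y. y \<in> lists A \<and> (w, p @ y) \<in> (rewrite_step A R)\<^sup>+}" (is "wf ?Q")
proof -
  let ?S = "rewrite_step A R"
  have wf': "wf ((?S\<^sup>+)\<inverse>)"
    using wf_trancl[OF wf] by (simp add: trancl_converse)
  have "w \<in> Wellfounded.acc ?Q" if "z = w @ y" "y \<in> lists A" for z w y
    using that
  proof (induction z arbitrary: w y rule: wf_induct_rule[OF wf'])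
    case (1 z)
    show ?case
    proof (rule acc.accI)
      fix p assume "(p, w) \<in> ?Q"
      then obtain y' where y': "y' \<in> lists A" "(w, p @ y') \<in> ?S\<^sup>+" by auto
      have "(w @ y, (p @ y') @ y) \<in> ?S\<^sup>+"
        using rewrite_steps_context(2)[OF _ 1(3) y'(2), of "[]"] by simp
      then show "p \<in> Wellfounded.acc ?Q"
        using 1(1)[of "p @ y' @ y" p "y' @ y"] 1(2,3) y'(1) by simp
    qed
  qed
  from this[of _ _ "[]"] have "\<forall>w. w \<in> Wellfounded.acc ?Q" by simp
  then show ?thesis by (rule acc_wfI)
qed

text \<open>The normal form of an element of \<open>S\<close> is the irreducible word that represents it, where the word
  \<open>w\<close> represents \<open>val w\<close>. Termination makes every word rewrite to some irreducible word, and
  uniqueness makes that word the normal form of its value.\<close>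

locale normal_forms =
  fixes A :: "'b set" and R :: "('b list \<times> 'b list) set" and val :: "'b list \<Rightarrow> 'g" and S :: "'g set"
  assumes wellformed_rules: "R \<subseteq> lists A \<times> lists A"
    and terminates: "wf ((rewrite_step A R)\<inverse>)"
    and val_in: "w \<in> lists A \<Longrightarrow> val w \<in> S"
    and val_step: "(w, w') \<in> rewrite_step A R \<Longrightarrow> val w' = val w"
    and unique_normal_form: "g \<in> S \<Longrightarrow> \<exists>!w. irreducible_word A R w \<and> val w = g"
begin

abbreviation "step \<equiv> rewrite_step A R"
abbreviation "irreducible \<equiv> irreducible_word A R"

definition nf :: "'g \<Rightarrow> 'b list" where
  "nf g = (THE w. irreducible w \<and> val w = g)"

lemma nf: "g \<in> S \<Longrightarrow> irreducible (nf g)" "g \<in> S \<Longrightarrow> val (nf g) = g"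
  using theI'[OF unique_normal_form[of g]] unfolding nf_def by auto

lemma irreducible_lists: "irreducible w \<Longrightarrow> w \<in> lists A"
  by (simp add: irreducible_word_def)

lemma nf_lists: "g \<in> S \<Longrightarrow> nf g \<in> lists A"
  by (rule irreducible_lists[OF nf(1)])

lemma nf_eqI: "irreducible w \<Longrightarrow> val w = g \<Longrightarrow> nf g = w"
  using unique_normal_form[of g] nf[of g] val_in[of w] irreducible_lists by blast

lemma rewrites_to_nf:
  assumes "w \<in> lists A"
  shows "(w, nf (val w)) \<in> step\<^sup>*"
proof -
  obtain w' where w': "(w, w') \<in> step\<^sup>*" "irreducible w'"
    by (rule terminating_reaches_irreducible[OF wellformed_rules terminates assms])
  from w'(1) have "val w' = val w"
    by induction (simp_all add: val_step)
  then show ?thesis using w' nf_eqI by simp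
qed

end

section \<open>Words, paths and trees in Cayley graphs\<close>

lemma word_value_simps [simp]:
  "word_value G [] = \<one>\<^bsub>G\<^esub>"
  "word_value G (a # w) = a \<otimes>\<^bsub>G\<^esub> word_value G w"
  by (simp_all add: word_value_def)

lemma (in monoid) word_value_closed:
  "w \<in> lists (carrier G) \<Longrightarrow> word_value G w \<in> carrier G"
  by (induction w) auto

lemma (in monoid) word_value_append:
  "w \<in> lists (carrier G) \<Longrightarrow> w' \<in> lists (carrier G)
    \<Longrightarrow> word_value G (w @ w') = word_value G w \<otimes> word_value G w'"
  by (induction w) (auto simp: word_value_closed m_assoc)

primrec path_from :: "('g, 'm) monoid_scheme \<Rightarrow> 'g \<Rightarrow> 'g list \<Rightarrow> ('g \<times> 'g) list" where
  "path_from G g [] = []"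
| "path_from G g (a # w) = (g, a) # path_from G (g \<otimes>\<^bsub>G\<^esub> a) w"

lemma path_label_path_from [simp]: "path_label (path_from G g w) = w"
  by (induction w arbitrary: g) (auto simp: path_label_def)

lemma length_path_from [simp]: "length (path_from G g w) = length w"
  by (induction w arbitrary: g) auto

lemma (in monoid) path_from_append:
  "g \<in> carrier G \<Longrightarrow> w \<in> lists (carrier G)
    \<Longrightarrow> path_from G g (w @ w') = path_from G g w @ path_from G (g \<otimes> word_value G w) w'"
  by (induction w arbitrary: g) (auto simp: m_assoc word_value_closed)

lemma (in monoid) edge_on_path_from:
  assumes "e \<in> set (path_from G g w)" and "g \<in> carrier G" and "w \<in> lists (carrier G)"
  obtains x a y where "w = x @ a # y" and "e = (g \<otimes> word_value G x, a)"
proof -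
  have "\<exists>x a y. w = x @ a # y \<and> e = (g \<otimes> word_value G x, a)"
    using assms
  proof (induction w arbitrary: g)
    case (Cons b w)
    show ?case
    proof (cases "e = (g, b)")
      case True
      then show ?thesis using Cons.prems by (intro exI[of _ "[]"]) auto
    next
      case False
      then obtain x a y where "w = x @ a # y" "e = (g \<otimes> b \<otimes> word_value G x, a)"
        using Cons.IH[of "g \<otimes> b"] Cons.prems by auto
      then show ?thesis using Cons.prems
        by (intro exI[of _ "b # x"]) (auto simp: m_assoc word_value_closed)
    qed
  qed simp
  then show thesis using that by blast
qed

lemma cayley_graph_simps [simp]:
  "verts (cayley_graph G A) = carrier G"
  "arcs (cayley_graph G A) = carrier G \<times> A"
  "tail (cayley_graph G A) = fst"
  "head (cayley_graph G A) = (\<lambda>(g, a). g \<otimes>\<^bsub>G\<^esub> a)"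
  by (simp_all add: cayley_graph_def)

lemma (in monoid) wf_digraph_cayley_graph:
  "A \<subseteq> carrier G \<Longrightarrow> wf_digraph (cayley_graph G A)"
  by unfold_locales auto

lemma (in monoid) awalk_path_from:
  assumes A: "A \<subseteq> carrier G" and "g \<in> carrier G" and "w \<in> lists A"
  shows "pre_digraph.awalk (cayley_graph G A) g (path_from G g w) (g \<otimes> word_value G w)"
proof -
  interpret C: wf_digraph "cayley_graph G A" by (rule wf_digraph_cayley_graph[OF A])
  show ?thesis using assms(2,3)
  proof (induction w arbitrary: g)
    case (Cons a w)
    then have *: "w \<in> lists (carrier G)" "a \<in> carrier G" using A by auto
    then have "g \<otimes> word_value G (a # w) = g \<otimes> a \<otimes> word_value G w"
      using Cons.prems(1) by (simp add: m_assoc word_value_closed)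
    then show ?case
      using Cons * by (auto simp del: word_value_simps simp: C.awalk_Cons_iff)
  qed (auto simp: C.awalk_Nil_iff)
qed

text \<open>At a deepest vertex of a cycle both neighbours on the cycle are its parent, and the vertices
  of a cycle of length at least 3 are too different for that.\<close>

lemma (in wf_digraph) rooted_no_long_cycle:
  fixes depth :: "'a \<Rightarrow> nat" and parent :: "'a \<Rightarrow> 'a"
  assumes down: "\<And>e. e \<in> arcs G \<Longrightarrow> depth (tail G e) \<le> depth (head G e) \<Longrightarrow> tail G e = parent (head G e)"
    and up: "\<And>e. e \<in> arcs G \<Longrightarrow> depth (head G e) \<le> depth (tail G e) \<Longrightarrow> head G e = parent (tail G e)"
    and "cycle p"
  shows "length p < 3"
proof (rule ccontr)
  assume "\<not> length p < 3"
  then have len: "3 \<le> length p" by simp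
  define n where "n = length p"
  obtain u where walk: "awalk u p u" and dist: "distinct (tl (awalk_verts u p))" and ne: "p \<noteq> []"
    using \<open>cycle p\<close> unfolding cycle_def by blast
  have arcs: "p ! k \<in> arcs G" if "k < n" for k
    using walk that unfolding awalk_def n_def by auto
  have verts: "map (tail G) p @ [head G (last p)] = tail G (hd p) # map (head G) p"
    using awalk_verts_conv[of u p] awalk_verts_conv'[of u p u] walk ne by (simp add: awalk_def)
  have dist: "distinct (map (head G) p)"
    using dist awalk_verts_conv'[of u p u] walk ne by (simp add: awalk_def)
  have ends: "tail G (hd p) = head G (last p)"
    using walk ne awalk_verts_conv[of u p] awlast_of_awalk[OF walk] cas_simp[OF ne]
    by (simp add: awalk_def)
  define after where "after k = (if Suc k = n then 0 else Suc k)" for k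
  have after: "after k < n" "tail G (p ! after k) = head G (p ! k)" if "k < n" for k
  proof -
    show "after k < n" using that by (simp add: after_def)
    have "(map (tail G) p @ [head G (last p)]) ! Suc k = head G (p ! k)"
      using that unfolding verts n_def by simp
    then show "tail G (p ! after k) = head G (p ! k)"
      using that ends ne by (auto simp: after_def n_def nth_append hd_conv_nth last_conv_nth)
  qed
  \<comment> \<open>The arc that enters a vertex of maximal depth, its predecessor and its successor.\<close>
  obtain i where i: "i < n" "\<And>k. k < n \<Longrightarrow> depth (head G (p ! k)) \<le> depth (head G (p ! i))"
  proof -
    let ?d = "\<lambda>k. depth (head G (p ! k))"
    have fin: "finite (?d ` {..<n})" "?d ` {..<n} \<noteq> {}" using ne by (auto simp: n_def)
    from Max_in[OF fin] obtain i where "Max (?d ` {..<n}) = ?d i" "i \<in> {..<n}" by (rule imageE)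
    then show thesis using that[of i] Max_ge[OF fin(1)] by auto
  qed
  define k where "k = (if i = 0 then n - 1 else i - 1)"
  have k: "k < n" "after k = i" using i(1) by (auto simp: k_def after_def)
  have "head G (p ! k) = parent (head G (p ! i))"
    using down[OF arcs[OF i(1)]] after(2)[OF k(1)] k(2) i(2)[OF k(1)] by simp
  moreover have "head G (p ! after i) = parent (head G (p ! i))"
    using up[OF arcs[OF after(1)[OF i(1)]]] after(2)[OF i(1)] i(2)[OF after(1)[OF i(1)]] by simp
  ultimately have "map (head G) p ! k = map (head G) p ! after i"
    using k(1) after(1)[OF i(1)] by (simp add: n_def)
  then have "k = after i"
    using nth_eq_iff_index_eq[OF dist, of k "after i"] k(1) after(1)[OF i(1)] by (simp add: n_def)
  then show False using len i(1) by (auto simp: k_def after_def n_def split: if_splits)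
qed

section \<open>Complete rewriting systems over a symmetric generating set\<close>

text \<open>The letters are group elements themselves, and every element has exactly one irreducible word.
  The rules form a list in order that a word with several applicable rules has a first one.\<close>

locale group_rewriting = group G for G :: "('g, 'm) monoid_scheme" (structure) +
  fixes A :: "'g set" and rules :: "('g list \<times> 'g list) list"
  assumes finite_letters: "finite A"
    and letters_closed: "A \<subseteq> carrier G"
    and inv_letter: "a \<in> A \<Longrightarrow> inv a \<in> A"
    and one_not_letter: "\<one> \<notin> A"
    and rules_lists: "set rules \<subseteq> lists A \<times> lists A"
    and rules_sound: "(u, v) \<in> set rules \<Longrightarrow> word_value G u = word_value G v"
    and terminating: "wf ((rewrite_step A (set rules))\<inverse>)"
    and unique_irreducible:
      "g \<in> carrier G \<Longrightarrow> \<exists>!w. irreducible_word A (set rules) w \<and> word_value G w = g"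
begin

abbreviation "\<Gamma> \<equiv> cayley_graph G A"

lemma words_closed: "w \<in> lists A \<Longrightarrow> w \<in> lists (carrier G)"
  using letters_closed by auto

lemma value_closed: "w \<in> lists A \<Longrightarrow> word_value G w \<in> carrier G"
  by (rule word_value_closed) (rule words_closed)

lemma value_append:
  "w \<in> lists A \<Longrightarrow> w' \<in> lists A \<Longrightarrow> word_value G (w @ w') = word_value G w \<otimes> word_value G w'"
  by (intro word_value_append words_closed)

lemma letter_closed [simp]: "a \<in> A \<Longrightarrow> a \<in> carrier G"
  using letters_closed by auto

lemma value_snoc: "w \<in> lists A \<Longrightarrow> a \<in> A \<Longrightarrow> word_value G (w @ [a]) = word_value G w \<otimes> a"
  by (subst value_append) auto

lemma step_value:
  assumes "(w, w') \<in> rewrite_step A (set rules)"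
  shows "word_value G w' = word_value G w"
proof -
  obtain x u v y where *: "w = x @ u @ y" "w' = x @ v @ y" "x \<in> lists A" "y \<in> lists A" "(u, v) \<in> set rules"
    using assms by (auto simp: rewrite_step_def)
  moreover have "u \<in> lists A" "v \<in> lists A" using *(5) rules_lists by auto
  ultimately show ?thesis
    using rules_sound[OF *(5)] by (simp add: value_append)
qed

sublocale normal_forms A "set rules" "word_value G" "carrier G"
  by unfold_locales (fact rules_lists terminating value_closed step_value unique_irreducible)+

subsection \<open>The tree of normal forms\<close>

text \<open>Prefixes of irreducible words are irreducible, so the normal forms span a tree: the parent of an
  element is reached by deleting the last letter of its normal form.\<close>

definition tree_edges :: "('g \<times> 'g) set" where
  "tree_edges = {(g, a). g \<in> carrier G \<and> a \<in> A \<and>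
     (nf (g \<otimes> a) = nf g @ [a] \<or> nf g = nf (g \<otimes> a) @ [inv a])}"

definition nf_tree :: "('g, 'g \<times> 'g) pre_digraph" where
  "nf_tree = \<Gamma>\<lparr>arcs := tree_edges\<rparr>"

lemma nf_tree_simps [simp]:
  "verts nf_tree = carrier G" "arcs nf_tree = tree_edges"
  "tail nf_tree = fst" "head nf_tree = (\<lambda>(g, a). g \<otimes> a)"
  by (simp_all add: nf_tree_def cayley_graph_def)

lemma tree_edges_subset: "tree_edges \<subseteq> carrier G \<times> A"
  by (auto simp: tree_edges_def)

sublocale cayley: wf_digraph \<Gamma>
  by (rule wf_digraph_cayley_graph[OF letters_closed])

sublocale tree: wf_digraph nf_tree
  using tree_edges_subset letters_closed by unfold_locales auto

lemma tree_edge_reverse: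
  "(g, a) \<in> tree_edges \<Longrightarrow> (g \<otimes> a, inv a) \<in> tree_edges"
  by (auto simp: tree_edges_def m_assoc inv_letter)

lemma tree_edge_of_irreducible:
  assumes "irreducible (w @ [a])"
  shows "(word_value G w, a) \<in> tree_edges" and "(word_value G (w @ [a]), inv a) \<in> tree_edges"
proof -
  have w: "w \<in> lists A" "a \<in> A" using irreducible_lists[OF assms] by auto
  have "irreducible w" using irreducible_factor[of A _ "[]" w "[a]"] assms by simp
  then have "nf (word_value G w) = w" "nf (word_value G w \<otimes> a) = w @ [a]"
    using w assms by (simp_all add: nf_eqI value_snoc)
  then show *: "(word_value G w, a) \<in> tree_edges"
    using w by (simp add: tree_edges_def value_closed)
  show "(word_value G (w @ [a]), inv a) \<in> tree_edges"
    using tree_edge_reverse[OF *] w by (simp add: value_snoc)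
qed

text \<open>Both conditions can be checked on the word \<open>nf g\<close> alone, without computing \<open>nf (g a)\<close>.\<close>

lemma tree_edge_iff:
  assumes "g \<in> carrier G" and "a \<in> A"
  shows "(g, a) \<in> tree_edges \<longleftrightarrow> irreducible (nf g @ [a]) \<or> (nf g \<noteq> [] \<and> last (nf g) = inv a)"
proof
  assume "(g, a) \<in> tree_edges"
  then show "irreducible (nf g @ [a]) \<or> (nf g \<noteq> [] \<and> last (nf g) = inv a)"
    using assms nf(1)[of "g \<otimes> a"] by (auto simp: tree_edges_def)
next
  assume "irreducible (nf g @ [a]) \<or> (nf g \<noteq> [] \<and> last (nf g) = inv a)"
  then show "(g, a) \<in> tree_edges"
  proof
    assume "irreducible (nf g @ [a])"
    then show ?thesis using tree_edge_of_irreducible(1)[of "nf g" a] assms by (simp add: nf)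
  next
    assume *: "nf g \<noteq> [] \<and> last (nf g) = inv a"
    then have "nf g = butlast (nf g) @ [inv a]" by (metis append_butlast_last_id)
    then show ?thesis
      using tree_edge_of_irreducible(2)[of "butlast (nf g)" "inv a"] assms nf[of g] by simp
  qed
qed

lemma tree_reachable:
  assumes "irreducible w"
  shows "\<one> \<rightarrow>\<^sup>*\<^bsub>nf_tree\<^esub> word_value G w \<and> word_value G w \<rightarrow>\<^sup>*\<^bsub>nf_tree\<^esub> \<one>"
  using assms
proof (induction w rule: rev_induct)
  case (snoc a w)
  have w: "w \<in> lists A" "a \<in> A" using irreducible_lists[OF snoc.prems] by auto
  have "irreducible w" using irreducible_factor[of A _ "[]" w "[a]"] snoc.prems by simp
  note IH = snoc.IH[OF this]
  have "word_value G w \<rightarrow>\<^bsub>nf_tree\<^esub> word_value G (w @ [a])"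
    using tree_edge_of_irreducible(1)[OF snoc.prems] w
    by (intro tree.dominatesI[where a = "(word_value G w, a)"]) (simp_all add: arc_to_ends_def value_snoc)
  moreover have "word_value G (w @ [a]) \<rightarrow>\<^bsub>nf_tree\<^esub> word_value G w"
    using tree_edge_of_irreducible(2)[OF snoc.prems] w
    by (intro tree.dominatesI[where a = "(word_value G (w @ [a]), inv a)"])
      (simp_all add: arc_to_ends_def value_snoc m_assoc value_closed)
  ultimately show ?case
    using tree.reachable_adj_trans[OF conjunct1[OF IH]] tree.adj_reachable_trans[OF _ conjunct2[OF IH]]
    by blast
qed simp

lemma tree_strongly_connected: "strongly_connected nf_tree"
proof (rule strongly_connectedI)
  fix g h assume "g \<in> verts nf_tree" "h \<in> verts nf_tree"
  then have "g \<rightarrow>\<^sup>*\<^bsub>nf_tree\<^esub> \<one>" "\<one> \<rightarrow>\<^sup>*\<^bsub>nf_tree\<^esub> h"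
    using tree_reachable[of "nf g"] tree_reachable[of "nf h"] by (simp_all add: nf)
  then show "g \<rightarrow>\<^sup>*\<^bsub>nf_tree\<^esub> h" by (rule tree.reachable_trans)
qed auto

lemma tree_no_long_cycle:
  assumes "pre_digraph.cycle nf_tree p"
  shows "length p < 3"
proof (rule tree.rooted_no_long_cycle[where depth = "\<lambda>g. length (nf g)"
      and parent = "\<lambda>g. word_value G (butlast (nf g))", OF _ _ assms])
  fix e assume e: "e \<in> arcs nf_tree"
  then obtain g a where [simp]: "e = (g, a)" and ga: "g \<in> carrier G" "a \<in> A"
    "nf (g \<otimes> a) = nf g @ [a] \<or> nf g = nf (g \<otimes> a) @ [inv a]"
    by (auto simp: tree_edges_def)
  have "nf (g \<otimes> a) = nf g @ [a]" if "length (nf g) \<le> length (nf (g \<otimes> a))"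
    using ga(3) that by auto
  then show "tail nf_tree e = word_value G (butlast (nf (head nf_tree e)))"
    if "length (nf (tail nf_tree e)) \<le> length (nf (head nf_tree e))"
    using that ga(1,2) by (simp add: nf)
  have "nf g = nf (g \<otimes> a) @ [inv a]" if "length (nf (g \<otimes> a)) \<le> length (nf g)"
    using ga(3) that by auto
  then show "head nf_tree e = word_value G (butlast (nf (tail nf_tree e)))"
    if "length (nf (head nf_tree e)) \<le> length (nf (tail nf_tree e))"
    using that ga(1,2) by (simp add: nf)
qed

text \<open>A further edge closes a cycle with the tree path between its ends. That path has length at least 2,
  because no letter is trivial and no two edges of a Cayley graph are parallel.\<close>

lemma maximal_tree_nf_tree: "maximal_tree G A nf_tree"
  unfolding maximal_tree_def cayley.max_subgraph_def
proof (intro conjI allI impI)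
  show "subgraph nf_tree \<Gamma>"
    using tree_edges_subset cayley.wf_digraph_axioms tree.wf_digraph_axioms
    by (auto simp: subgraph_def compatible_def)
  have "connected nf_tree"
    unfolding connected_def
    using tree_strongly_connected tree.reachable_mk_symmetricI
    by (auto simp: strongly_connected_def)
  moreover have "\<nexists>p. tree.cycle p \<and> 3 \<le> length p"
    using tree_no_long_cycle by fastforce
  ultimately show "undirected_tree G nf_tree"
    using tree_edge_reverse by (auto simp: undirected_tree_def)
next
  fix H assume H: "H \<noteq> nf_tree \<and> subgraph nf_tree H"
  show "\<not> (subgraph H \<Gamma> \<and> undirected_tree G H)"
  proof
    assume *: "subgraph H \<Gamma> \<and> undirected_tree G H"
    interpret H: wf_digraph H using H by (simp add: subgraph_def)
    have simps: "verts H = carrier G" "tail H = fst" "head H = (\<lambda>(g, a). g \<otimes> a)"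
      using H * by (auto simp: subgraph_def compatible_def)
    have "arcs H \<noteq> tree_edges"
      using H simps by (auto simp: nf_tree_def cayley_graph_def)
    then obtain g a where e: "(g, a) \<in> arcs H" "(g, a) \<notin> tree_edges"
      using H by (auto simp: subgraph_def)
    then have ga: "g \<in> carrier G" "a \<in> A"
      using * by (auto simp: subgraph_def)
    obtain p where p: "tree.apath (g \<otimes> a) p g"
    proof -
      have "(g \<otimes> a) \<rightarrow>\<^sup>*\<^bsub>nf_tree\<^esub> g"
        using tree_strongly_connected ga by (simp add: strongly_connected_def)
      then show thesis using that unfolding tree.reachable_apath by blast
    qed
    have "H.apath (g \<otimes> a) p g"
      using H.subgraph_apath_imp_apath[OF p] H by blast
    then have cycle: "H.cycle ((g, a) # p)"
      using e(1) by (auto simp: H.cycle_def H.apath_def H.awalk_Cons_iff simps)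
    have ne0: "p \<noteq> []"
    proof
      assume "p = []"
      then have "g \<otimes> a = g" using p by (simp add: tree.apath_Nil_iff)
      then have "a = \<one>" using ga by simp
      then show False using ga one_not_letter by simp
    qed
    have ne1: "length p \<noteq> 1"
    proof
      assume "length p = 1"
      then obtain e' where e': "p = [e']" by (auto simp: length_Suc_conv)
      then have "e' \<in> tree_edges" "fst e' = g \<otimes> a" "fst e' \<otimes> snd e' = g"
        using p by (auto simp: tree.apath_def tree.awalk_simps split: prod.splits)
      then obtain b where b: "(g \<otimes> a, b) \<in> tree_edges" "g \<otimes> a \<otimes> b = g" by (cases e') auto
      then have "(g, inv b) \<in> tree_edges" using tree_edge_reverse[of "g \<otimes> a" b] by simp
      moreover have "inv b = a"
      proof (rule inv_equality)
        have "b \<in> carrier G" using b(1) tree_edges_subset by auto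
        then show "b \<in> carrier G" "a \<otimes> b = \<one>" using b(2) ga by (simp_all add: m_assoc)
      qed (use ga in simp)
      ultimately show False using e(2) by simp
    qed
    have "3 \<le> length ((g, a) # p)"
      using ne0 ne1 by (cases p) (auto simp: Suc_le_eq)
    then show False using * cycle unfolding undirected_tree_def by blast
  qed
qed

subsection \<open>The flow function\<close>

definition first_rule :: "'g list \<Rightarrow> ('g list \<times> 'g list) option" where
  "first_rule w = find (\<lambda>(u, v). suffix u w) rules"

text \<open>For a rule \<open>u a \<rightarrow> v\<close>, going back along \<open>u\<close> and then along \<open>v\<close> replaces an edge labelled \<open>a\<close>.\<close>

definition detour :: "'g list \<times> 'g list \<Rightarrow> 'g list" where
  "detour = (\<lambda>(u, v). rev (map (\<lambda>b. inv b) (butlast u)) @ v)"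

definition flow_label :: "'g \<Rightarrow> 'g \<Rightarrow> 'g list" where
  "flow_label g a = (if (g, a) \<in> tree_edges then [a]
     else case first_rule (nf g @ [a]) of None \<Rightarrow> [a] | Some r \<Rightarrow> detour r)"

definition flow :: "'g \<times> 'g \<Rightarrow> ('g \<times> 'g) list" where
  "flow = (\<lambda>(g, a). path_from G g (flow_label g a))"

lemma first_rule_SomeD: "first_rule w = Some (u, v) \<Longrightarrow> (u, v) \<in> set rules \<and> suffix u w"
  unfolding first_rule_def find_Some_iff by (auto simp: in_set_conv_nth)

lemma first_rule_None_iff:
  assumes "irreducible w" and "a \<in> A"
  shows "first_rule (w @ [a]) = None \<longleftrightarrow> irreducible (w @ [a])"
proof
  assume "first_rule (w @ [a]) = None"
  then have "\<And>u v. (u, v) \<in> set rules \<Longrightarrow> \<not> suffix u (w @ [a])"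
    unfolding first_rule_def find_None_iff by auto
  then show "irreducible (w @ [a])"
    using reducible_last_letter[OF assms] by metis
next
  assume irr: "irreducible (w @ [a])"
  have False if "(u, v) \<in> set rules" "suffix u (w @ [a])" for u v
  proof -
    obtain x where x: "w @ [a] = x @ u" using \<open>suffix u _\<close> by (auto simp: suffix_def)
    then have "x @ u \<in> lists A" using irreducible_lists[OF irr] by simp
    then have "(x @ u @ [], x @ v @ []) \<in> step"
      using that(1) by (intro rewrite_step_rule) simp_all
    then show False using irr x by (auto simp: irreducible_word_def)
  qed
  then show "first_rule (w @ [a]) = None"
    unfolding first_rule_def find_None_iff by auto
qed

text \<open>For a non-tree edge \<open>(g, a)\<close> the word \<open>nf g a\<close> is reducible although \<open>nf g\<close> is not, so a
  left-hand side occurs at its end; it contains the last letter \<open>a\<close>.\<close>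

lemma non_tree_edge:
  assumes "g \<in> carrier G" and "a \<in> A" and "(g, a) \<notin> tree_edges"
  obtains x u v where "(u @ [a], v) \<in> set rules" and "nf g = x @ u"
    and "x \<in> lists A" and "u \<in> lists A" and "v \<in> lists A"
    and "flow_label g a = rev (map (\<lambda>b. inv b) u) @ v"
proof -
  have "\<not> irreducible (nf g @ [a])" using assms tree_edge_iff by simp
  then have "first_rule (nf g @ [a]) \<noteq> None"
    using first_rule_None_iff[OF nf(1)[OF assms(1)] assms(2)] by simp
  then obtain u' v where r: "first_rule (nf g @ [a]) = Some (u', v)" by fast
  then have rule: "(u', v) \<in> set rules" and suff: "suffix u' (nf g @ [a])"
    using first_rule_SomeD by blast+
  have "u' \<noteq> []" using terminating_lhs_nonempty[OF rules_lists terminating] rule by auto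
  then obtain u where u: "u' = u @ [a]" "suffix u (nf g)"
    using suff by (auto simp: suffix_snoc)
  then obtain x where x: "nf g = x @ u" by (auto simp: suffix_def)
  have "x \<in> lists A" "u \<in> lists A" using nf_lists[OF assms(1)] x by simp_all
  moreover have "v \<in> lists A" using rule rules_lists by auto
  moreover have "flow_label g a = rev (map (\<lambda>b. inv b) u) @ v"
    using assms(3) r u(1) by (simp add: flow_label_def detour_def)
  ultimately show thesis by (rule that[OF rule[unfolded u(1)] x])
qed

lemma inverse_word:
  assumes "u \<in> lists A"
  shows "rev (map (\<lambda>b. inv b) u) \<in> lists A"
    and "word_value G (rev (map (\<lambda>b. inv b) u)) = inv (word_value G u)"
proof -
  have *: "rev (map (\<lambda>b. inv b) u) \<in> lists A" if "u \<in> lists A" for u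
    using that by (induction u) (simp_all add: inv_letter)
  show "rev (map (\<lambda>b. inv b) u) \<in> lists A" by (rule *[OF assms])
  show "word_value G (rev (map (\<lambda>b. inv b) u)) = inv (word_value G u)"
    using assms
  proof (induction u)
    case (Cons a u)
    then have u: "u \<in> lists A" "a \<in> A" by simp_all
    show ?case
      using value_snoc[OF *[OF u(1)] inv_letter[OF u(2)]] Cons.IH u
      by (simp add: inv_mult_group value_closed)
  qed simp
qed

lemma flow_label_lists:
  assumes "g \<in> carrier G" and "a \<in> A"
  shows "flow_label g a \<in> lists A"
proof (cases "(g, a) \<in> tree_edges")
  case False
  obtain x u v where "(u @ [a], v) \<in> set rules" "nf g = x @ u" "x \<in> lists A"
      "u \<in> lists A" "v \<in> lists A" "flow_label g a = rev (map (\<lambda>b. inv b) u) @ v"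
    by (rule non_tree_edge[OF assms False])
  then show ?thesis using inverse_word(1)[of u] by simp
qed (use assms in \<open>simp add: flow_label_def\<close>)

lemma flow_label_value:
  assumes g: "g \<in> carrier G" and a: "a \<in> A"
  shows "g \<otimes> word_value G (flow_label g a) = g \<otimes> a"
proof (cases "(g, a) \<in> tree_edges")
  case False
  obtain x u v where *: "(u @ [a], v) \<in> set rules" "nf g = x @ u" "x \<in> lists A" "u \<in> lists A"
      "v \<in> lists A" "flow_label g a = rev (map (\<lambda>b. inv b) u) @ v"
    by (rule non_tree_edge[OF assms False])
  have "word_value G v = word_value G u \<otimes> a"
    using rules_sound[OF *(1)] * a by (simp add: value_snoc)
  then have "word_value G (flow_label g a) = inv (word_value G u) \<otimes> (word_value G u \<otimes> a)"
    using * by (simp add: value_append inverse_word)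
  also have "\<dots> = a"
    using a * by (simp add: m_assoc[symmetric] value_closed)
  finally show ?thesis by simp
qed (use assms in \<open>simp add: flow_label_def\<close>)

lemma bounded_flow_flow: "bounded_flow G A flow"
proof -
  have "length (flow_label g a) \<le> Suc (\<Sum>r\<in>set rules. length (detour r))" for g a
  proof (cases "first_rule (nf g @ [a])")
    case (Some r)
    then have "r \<in> set rules" using first_rule_SomeD[of _ "fst r" "snd r"] by simp
    then have "length (detour r) \<le> (\<Sum>r\<in>set rules. length (detour r))"
      by (intro member_le_sum) simp_all
    then show ?thesis using Some by (simp add: flow_label_def)
  qed (simp add: flow_label_def)
  then show ?thesis
    unfolding bounded_flow_def flow_def by (intro exI) (auto simp: split_beta)
qed

text \<open>The way back from \<open>x u\<close> along \<open>u\<close> passes through the prefixes of an irreducible word.\<close>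

lemma backward_path_in_tree:
  assumes "irreducible (x @ u)"
  shows "set (path_from G (word_value G (x @ u)) (rev (map (\<lambda>b. inv b) u))) \<subseteq> tree_edges"
  using assms
proof (induction u rule: rev_induct)
  case (snoc a u)
  then have irr: "irreducible ((x @ u) @ [a])" by simp
  have words: "x \<in> lists A" "u \<in> lists A" "a \<in> A" using irreducible_lists[OF irr] by simp_all
  have "irreducible (x @ u)" using irreducible_factor[of A _ "[]" "x @ u" "[a]"] irr by simp
  then have "set (path_from G (word_value G (x @ u)) (rev (map (\<lambda>b. inv b) u))) \<subseteq> tree_edges"
    by (rule snoc.IH)
  moreover have "word_value G ((x @ u) @ [a]) \<otimes> inv a = word_value G (x @ u)"
    using words value_snoc[of "x @ u" a] by (simp add: m_assoc value_closed)
  moreover have "(word_value G ((x @ u) @ [a]), inv a) \<in> tree_edges"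
    by (rule tree_edge_of_irreducible(2)[OF irr])
  ultimately show ?case by simp
qed simp

text \<open>The word \<open>nf g a\<close> of a non-tree edge \<open>(g, a)\<close> is \<open>x u a\<close> for the rule \<open>u a \<rightarrow> v\<close> that is used.
  The way back along \<open>u\<close> stays in the tree. An edge after it is \<open>(x p, c)\<close> with \<open>v = p c q\<close>,
  and \<open>x u a\<close> rewrites to \<open>x p c q\<close> and hence to \<open>nf (x p) c q\<close>, which has the word of that edge
  as a prefix.\<close>

lemma flow_edge_smaller:
  assumes g: "g \<in> carrier G" and a: "a \<in> A" and "(g, a) \<notin> tree_edges"
    and "e \<in> set (flow (g, a))" and "e \<notin> tree_edges"
  obtains h c y where "e = (h, c)" and "y \<in> lists A" and "(nf g @ [a], (nf h @ [c]) @ y) \<in> step\<^sup>+"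
proof -
  obtain x u v where *: "(u @ [a], v) \<in> set rules" "nf g = x @ u" and
      words: "x \<in> lists A" "u \<in> lists A" "v \<in> lists A" and
      label: "flow_label g a = rev (map (\<lambda>b. inv b) u) @ v"
    by (rule non_tree_edge[OF assms(1-3)])
  have irr: "irreducible (x @ u)" and gval: "word_value G (x @ u) = g"
    using nf[OF g] *(2) by simp_all
  have base: "g \<otimes> word_value G (rev (map (\<lambda>b. inv b) u)) = word_value G x"
  proof -
    have "g = word_value G x \<otimes> word_value G u"
      using gval words by (simp add: value_append)
    then show ?thesis using words by (simp add: inverse_word m_assoc value_closed)
  qed
  have "flow (g, a) = path_from G g (rev (map (\<lambda>b. inv b) u)) @ path_from G (word_value G x) v"
    unfolding flow_def prod.case label base[symmetric]
    by (rule path_from_append) (use g words inverse_word(1) words_closed in simp_all)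
  then have "e \<in> set (path_from G (word_value G x) v)"
    using backward_path_in_tree[OF irr] assms(4,5) gval by auto
  then obtain p c q where v: "v = p @ c # q" and e: "e = (word_value G x \<otimes> word_value G p, c)"
    using edge_on_path_from[OF _ value_closed[OF words(1)] words_closed[OF words(3)]] by blast
  have pcq: "p \<in> lists A" "c \<in> A" "q \<in> lists A" using words(3) v by simp_all
  define h where "h = word_value G (x @ p)"
  have "(x @ (u @ [a]) @ [], x @ v @ []) \<in> step"
    by (rule rewrite_step_rule) (use * words in simp_all)
  moreover have "([] @ (x @ p) @ (c # q), [] @ nf h @ (c # q)) \<in> step\<^sup>*"
    unfolding h_def
    by (rule rewrite_steps_context(1)[OF _ _ rewrites_to_nf]) (use words pcq in simp_all)
  ultimately have "(nf g @ [a], (nf h @ [c]) @ q) \<in> step\<^sup>+"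
    using *(2) v by (simp add: rtrancl_into_trancl2)
  then show thesis
    using that[of h c q] e words pcq by (simp add: h_def value_append)
qed

lemma flow_function_flow: "flow_function G A nf_tree flow"
  unfolding flow_function_def
proof (intro conjI ballI impI)
  fix e assume e: "e \<in> arcs \<Gamma>"
  then obtain g a where [simp]: "e = (g, a)" and ga: "g \<in> carrier G" "a \<in> A" by auto
  show "cayley.awalk (tail \<Gamma> e) (flow e) (head \<Gamma> e)"
    using awalk_path_from[OF letters_closed ga(1) flow_label_lists[OF ga]] flow_label_value[OF ga]
    by (simp add: flow_def)
  show "flow e = [e]" if "e \<in> arcs nf_tree"
    using that by (simp add: flow_def flow_label_def)
next
  let ?Q = "{(p, w). \<exists>y. y \<in> lists A \<and> (w, p @ y) \<in> step\<^sup>+}"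
  have "(e', e) \<in> inv_image ?Q (\<lambda>(g, a). nf g @ [a])"
    if less: "(e', e) \<in> flow_less G A nf_tree flow" for e' e
  proof -
    obtain g a where [simp]: "e = (g, a)" by fastforce
    obtain h c y where "e' = (h, c)" "y \<in> lists A" "(nf g @ [a], (nf h @ [c]) @ y) \<in> step\<^sup>+"
      using flow_edge_smaller[of g a e'] less by (auto simp: flow_less_def)
    then show ?thesis by auto
  qed
  then have "flow_less G A nf_tree flow \<subseteq> inv_image ?Q (\<lambda>(g, a). nf g @ [a])"
    by (rule subrelI)
  then have "wf (flow_less G A nf_tree flow)"
    by (rule wf_subset[OF wf_inv_image[OF wf_rewrite_to_prefix[OF rules_lists terminating]]])
  then show "wf ((flow_less G A nf_tree flow)\<^sup>+)"
    by (rule wf_trancl)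
qed

lemma flow_graph_flow:
  "flow_graph G A flow = {(w, a, flow_label (word_value G w) a) | w a. w \<in> lists A \<and> a \<in> A}"
  by (simp add: flow_graph_def flow_def)

lemma generating_letters: "symmetric_generating_set G A"
proof -
  have "word_value G w \<in> generate G A" if "w \<in> lists A" for w
    using that by induction (auto intro: generate.intros)
  then have "g \<in> generate G A" if "g \<in> carrier G" for g
    using nf(2)[OF that] nf_lists[OF that] by metis
  then show ?thesis
    using generate_incl[OF letters_closed] letters_closed inv_letter
    by (auto simp: symmetric_generating_set_def)
qed

end

section \<open>Computing normal forms\<close>

lemma recursive_set_if_decidable:
  assumes "decidable n P"
  shows "recursive_set n {xs. length xs = n \<and> P xs}"
  using assms unfolding recursive_set_def decidable_def computable_def by (auto simp: of_bool_def)

text \<open>A machine with a stack and an input, both coded by numbering the letters with \<open>c\<close>, computes normal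
  forms. The stack holds an irreducible word in reverse order, so that its last letter is on top.
  A step pushes the next letter; if then a left-hand side lies on top of the stack, it is removed and
  the right-hand side is put in front of the input. A number that codes no letter stops the
  machine and stays in the input, which reveals that the input did not code a word.\<close>

definition matching_rule :: "('g \<Rightarrow> nat) \<Rightarrow> ('g list \<times> 'g list) list \<Rightarrow> nat list \<Rightarrow> ('g list \<times> 'g list) option" where
  "matching_rule c rules s = find (\<lambda>r. prefix (map c (rev (fst r))) s) rules"

definition halted :: "('g \<Rightarrow> nat) \<Rightarrow> 'g set \<Rightarrow> nat list \<times> nat list \<Rightarrow> bool" where
  "halted c A z \<longleftrightarrow> snd z = [] \<or> hd (snd z) \<notin> c ` A"

definition reduce_step ::
    "('g \<Rightarrow> nat) \<Rightarrow> 'g set \<Rightarrow> ('g list \<times> 'g list) list \<Rightarrow> nat list \<times> nat list \<Rightarrow> nat list \<times> nat list" where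
  "reduce_step c A rules z = (if halted c A z then z else
     let s = hd (snd z) # fst z; t = tl (snd z) in
     case matching_rule c rules s of None \<Rightarrow> (s, t)
     | Some r \<Rightarrow> (drop (length (fst r)) s, map c (snd r) @ t))"

definition reduce ::
    "('g \<Rightarrow> nat) \<Rightarrow> 'g set \<Rightarrow> ('g list \<times> 'g list) list \<Rightarrow> nat list \<Rightarrow> nat list \<times> nat list" where
  "reduce c A rules w =
     (reduce_step c A rules ^^ (LEAST k. halted c A ((reduce_step c A rules ^^ k) ([], w)))) ([], w)"

definition encode_state :: "nat list \<times> nat list \<Rightarrow> nat" where
  "encode_state z = prod_encode (list_encode (fst z), list_encode (snd z))"

definition decode_state :: "nat \<Rightarrow> nat list \<times> nat list" where
  "decode_state m = (list_decode (fst (prod_decode m)), list_decode (snd (prod_decode m)))"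

lemma decode_encode_state [simp]: "decode_state (encode_state z) = z"
  by (simp add: decode_state_def encode_state_def)

lemma encode_decode_state [simp]: "encode_state (decode_state m) = m"
  by (simp add: decode_state_def encode_state_def)

lemma computable_list_decode:
  "computable n f \<Longrightarrow> computable_list n (\<lambda>xs. list_decode (f xs))"
  by (simp add: computable_list_def)

lemma computable_encode_state:
  "computable_list n f \<Longrightarrow> computable_list n g \<Longrightarrow> computable n (\<lambda>xs. encode_state (f xs, g xs))"
  by (simp add: encode_state_def computable_list_def computable_prod_encode)

lemma computable_decode_state:
  assumes "computable n f"
  shows "computable_list n (\<lambda>xs. fst (decode_state (f xs)))"
    and "computable_list n (\<lambda>xs. snd (decode_state (f xs)))"
  unfolding decode_state_def fst_conv snd_conv
  by (rule computable_list_decode, rule computable_prod_decode[OF assms])+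

lemma decidable_halted:
  assumes "finite A" and f: "computable n f"
  shows "decidable n (\<lambda>xs. halted c A (decode_state (f xs)))"
proof (rule decidable_cong)
  show "decidable n (\<lambda>xs. \<not> (\<exists>a\<in>A. snd (decode_state (f xs)) \<noteq> [] \<and> hd (snd (decode_state (f xs))) = c a))"
    by (rule decidable_not[OF decidable_Bex_finite[OF assms(1)
        decidable_head_eq[OF computable_decode_state(2)[OF f] computable_const]]])
qed (auto simp: halted_def)

lemma computable_reduce_step:
  assumes "finite A" and f: "computable n f"
  shows "computable n (\<lambda>xs. encode_state (reduce_step c A rules (decode_state (f xs))))"
proof -
  let ?z = "\<lambda>xs. decode_state (f xs)"
  let ?s = "\<lambda>xs. (if snd (?z xs) = [] then 0 else hd (snd (?z xs))) # fst (?z xs)"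
  let ?t = "\<lambda>xs. tl (snd (?z xs))"
  have s: "computable_list n ?s"
    by (rule computable_list_Cons[OF computable_head computable_decode_state(1)[OF f]])
      (rule computable_decode_state(2)[OF f])
  have t: "computable_list n ?t"
    by (rule computable_list_tl[OF computable_decode_state(2)[OF f]])
  let ?c = "\<lambda>xs. case find (\<lambda>r. prefix (map c (rev (fst r))) (?s xs)) rules of
      None \<Rightarrow> encode_state (?s xs, ?t xs)
    | Some r \<Rightarrow> encode_state (drop (length (fst r)) (?s xs), map c (snd r) @ ?t xs)"
  have "computable n ?c"
    by (rule computable_case_find)
      (rule decidable_prefix[OF s] computable_encode_state[OF s t]
        computable_encode_state[OF computable_list_drop[OF s] computable_list_append_const[OF t]])+
  from computable_if[OF decidable_halted[OF assms] f this] show ?thesis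
    by (rule computable_cong)
      (auto simp: reduce_step_def Let_def halted_def matching_rule_def split: option.split)
qed

text \<open>The number of steps until the machine stops is found by unbounded search.\<close>

lemma computable_reduce:
  assumes "finite A" and halts: "\<And>w. \<exists>k. halted c A ((reduce_step c A rules ^^ k) ([], w))"
    and f: "computable_list n f"
  shows "computable_list n (\<lambda>xs. fst (reduce c A rules (f xs)))"
    and "computable_list n (\<lambda>xs. snd (reduce c A rules (f xs)))"
proof -
  define F where "F m = encode_state (reduce_step c A rules (decode_state m))" for m
  have F: "computable 1 (\<lambda>ys. F (ys ! 0))"
    unfolding F_def by (rule computable_reduce_step[OF assms(1)]) (simp add: computable_nth)
  have F_pow: "(F ^^ k) (encode_state z) = encode_state ((reduce_step c A rules ^^ k) z)" for k z
    by (induction k) (simp_all add: F_def)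
  have start: "computable m (\<lambda>ys. encode_state ([], list_decode (ys ! i)))" if "i < m" for m i
    by (intro computable_encode_state computable_list_const computable_list_decode computable_nth that)
  have run: "computable 2 (\<lambda>ys. (F ^^ (ys ! 0)) (encode_state ([], list_decode (ys ! 1))))"
    by (rule computable_funpow[OF F computable_nth start]) simp_all
  have "computable 1 (\<lambda>ys. LEAST k.
      halted c A (decode_state ((F ^^ ((k # ys) ! 0)) (encode_state ([], list_decode ((k # ys) ! 1))))))"
  proof (rule computable_Least[where
      P = "\<lambda>ys. halted c A (decode_state ((F ^^ (ys ! 0)) (encode_state ([], list_decode (ys ! 1)))))"])
    show "decidable (Suc 1)
        (\<lambda>ys. halted c A (decode_state ((F ^^ (ys ! 0)) (encode_state ([], list_decode (ys ! 1))))))"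
      using decidable_halted[OF assms(1) run] by (simp add: numeral_2_eq_2)
  qed (use halts in \<open>simp add: F_pow\<close>)
  from computable_funpow[OF F this start]
  have "computable 1 (\<lambda>ys. encode_state (reduce c A rules (list_decode (ys ! 0))))"
    by (simp add: F_pow reduce_def)
  then have "computable n (\<lambda>xs. encode_state (reduce c A rules (list_decode (list_encode (f xs)))))"
    by (rule computable_unary) (use f in \<open>simp add: computable_list_def\<close>)
  then have *: "computable n (\<lambda>xs. encode_state (reduce c A rules (f xs)))"
    by simp
  show "computable_list n (\<lambda>xs. fst (reduce c A rules (f xs)))"
    using computable_decode_state(1)[OF *] by simp
  show "computable_list n (\<lambda>xs. snd (reduce c A rules (f xs)))"
    using computable_decode_state(2)[OF *] by simp
qed

lemma reduce_eqI:
  assumes "(reduce_step c A rules ^^ k) ([], w) = z" and "halted c A z"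
  shows "reduce c A rules w = z"
proof -
  let ?F = "reduce_step c A rules"
  let ?k = "LEAST k. halted c A ((?F ^^ k) ([], w))"
  have "halted c A ((?F ^^ ?k) ([], w))" and "?k \<le> k"
    using assms LeastI[of "\<lambda>k. halted c A ((?F ^^ k) ([], w))" k]
      Least_le[of "\<lambda>k. halted c A ((?F ^^ k) ([], w))" k] by auto
  then have fixed: "?F ((?F ^^ ?k) ([], w)) = (?F ^^ ?k) ([], w)"
    by (simp add: reduce_step_def)
  have "(?F ^^ (j + ?k)) ([], w) = (?F ^^ ?k) ([], w)" for j
    by (induction j) (simp_all add: fixed)
  from this[of "k - ?k"] show ?thesis
    using assms(1) \<open>?k \<le> k\<close> by (simp add: reduce_def)
qed

lemma prefix_map_inj_on:
  assumes "inj_on c A" and "p \<in> lists A" and "q \<in> lists A"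
  shows "prefix (map c p) (map c q) \<longleftrightarrow> prefix p q"
proof
  assume "prefix (map c p) (map c q)"
  then obtain l where l: "map c q = map c p @ l" by (auto simp: prefix_def)
  then have "map c (take (length p) q) = map c p"
    by (metis append_eq_conv_conj length_map take_map)
  moreover have "inj_on c (set (take (length p) q) \<union> set p)"
    using assms set_take_subset[of "length p" q] by (intro inj_on_subset[OF assms(1)]) auto
  ultimately have "take (length p) q = p"
    using inj_on_map_eq_map by blast
  then show "prefix p q" by (metis take_is_prefix)
qed (rule map_mono_prefix)

context group_rewriting
begin

lemma matching_rule_eq:
  assumes c: "inj_on c A" and w: "w \<in> lists A"
  shows "matching_rule c rules (map c (rev w)) = first_rule w"
  unfolding matching_rule_def first_rule_def
proof (rule find_cong[OF HOL.refl])
  fix r assume r: "r \<in> set rules"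
  then have "fst r \<in> lists A" using rules_lists by auto
  then have "rev (fst r) \<in> lists A" "rev w \<in> lists A" using w by auto
  then show "prefix (map c (rev (fst r))) (map c (rev w)) = (case r of (u, v) \<Rightarrow> suffix u w)"
    using prefix_map_inj_on[OF c] by (simp add: split_beta suffix_to_prefix)
qed

text \<open>The stack always holds an irreducible word, reversed. A step either rewrites the word
  that stack and input spell together, or keeps it and shortens the input; so the machine stops at
  the normal form.\<close>

lemma reduce_step_reaches_nf:
  assumes c: "inj_on c A" and J: "J = [] \<or> hd J \<notin> c ` A"
    and "irreducible w" and "t \<in> lists A"
  shows "\<exists>k. (reduce_step c A rules ^^ k) (map c (rev w), map c t @ J)
    = (map c (rev (nf (word_value G (w @ t)))), J)"
proof -
  have wf: "wf (inv_image (step\<inverse> <*lex*> measure length) (\<lambda>(w, t). (w @ t, t)))"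
    using terminating by (intro wf_inv_image wf_lex_prod wf_measure)
  have "irreducible w \<Longrightarrow> t \<in> lists A \<Longrightarrow> \<exists>k. (reduce_step c A rules ^^ k) (map c (rev w), map c t @ J)
    = (map c (rev (nf (word_value G (w @ t)))), J)" for w t
  proof (induction "(w, t)" arbitrary: w t rule: wf_induct_rule[OF wf])
    case 1
    note irr = 1(2) and t = 1(3)
    show ?case
    proof (cases t)
      case Nil
      then show ?thesis using nf_eqI[OF irr HOL.refl] by (intro exI[of _ 0]) simp
    next
      case (Cons b t')
      have b: "b \<in> A" "t' \<in> lists A" using t Cons by simp_all
      have w: "w \<in> lists A" using irreducible_lists[OF irr] .
      have match: "matching_rule c rules (c b # map c (rev w)) = first_rule (w @ [b])"
        using matching_rule_eq[OF c, of "w @ [b]"] w b by simp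
      have running: "\<not> halted c A (map c (rev w), map c t @ J)"
        using Cons b by (simp add: halted_def)
      obtain w' t'' where first: "reduce_step c A rules (map c (rev w), map c t @ J)
            = (map c (rev w'), map c t'' @ J)"
        and inv: "irreducible w'" "t'' \<in> lists A" "word_value G (w' @ t'') = word_value G (w @ t)"
        and less: "((w' @ t'', t''), (w @ t, t)) \<in> step\<inverse> <*lex*> measure length"
      proof (cases "first_rule (w @ [b])")
        case None
        show thesis
        proof (rule that)
          show "reduce_step c A rules (map c (rev w), map c t @ J) = (map c (rev (w @ [b])), map c t' @ J)"
            using running match None Cons by (simp add: reduce_step_def)
          show "irreducible (w @ [b])" using None first_rule_None_iff[OF irr b(1)] by simp
        qed (use b Cons in simp_all)
      next
        case (Some r)
        obtain u v where r: "r = (u, v)" by fastforce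
        then have rule: "(u, v) \<in> set rules" "suffix u (w @ [b])"
          using first_rule_SomeD Some by blast+
        then obtain x where x: "w @ [b] = x @ u" by (auto simp: suffix_def)
        have u: "u \<noteq> []" using terminating_lhs_nonempty[OF rules_lists terminating] rule by auto
        then obtain u' where u': "u = u' @ [b]" "w = x @ u'"
          using x by (metis append_assoc append_butlast_last_id butlast_append butlast_snoc last_appendR last_snoc)
        have lists: "x \<in> lists A" "v \<in> lists A" using u'(2) w rule(1) rules_lists by auto
        have wt: "w @ t = x @ u @ t'" using Cons u' by simp
        have st: "(w @ t, x @ v @ t') \<in> step"
          unfolding wt by (rule rewrite_step_rule) (use rule lists b in simp_all)
        show thesis
        proof (rule that)
          have "map c (rev w) = map c (rev u') @ map c (rev x)" using u' by simp
          then show "reduce_step c A rules (map c (rev w), map c t @ J) = (map c (rev x), map c (v @ t') @ J)"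
            using running match Some Cons u' r by (simp add: reduce_step_def)
          show "irreducible x" using irreducible_factor[of A _ "[]" x u'] irr u' by simp
          show "word_value G (x @ v @ t') = word_value G (w @ t)" using step_value[OF st] .
        qed (use st lists b in simp_all)
      qed
      obtain k where "(reduce_step c A rules ^^ k) (map c (rev w'), map c t'' @ J)
          = (map c (rev (nf (word_value G (w' @ t'')))), J)"
        using 1(1)[of w' t''] inv less by auto
      then have "(reduce_step c A rules ^^ Suc k) (map c (rev w), map c t @ J)
          = (map c (rev (nf (word_value G (w @ t)))), J)"
        using first inv(3) by (simp add: funpow_Suc_right del: funpow.simps)
      then show ?thesis by blast
    qed
  qed
  then show ?thesis using assms(3,4) by blast
qed

lemma reduce_run:
  assumes "inj_on c A" and "J = [] \<or> hd J \<notin> c ` A" and "t \<in> lists A"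
  shows "\<exists>k. (reduce_step c A rules ^^ k) ([], map c t @ J) = (map c (rev (nf (word_value G t))), J)"
  using reduce_step_reaches_nf[OF assms(1,2) terminating_Nil_irreducible[OF rules_lists terminating]
      assms(3)] by simp

lemma reduce_eq:
  assumes "inj_on c A" and "J = [] \<or> hd J \<notin> c ` A" and "t \<in> lists A"
  shows "reduce c A rules (map c t @ J) = (map c (rev (nf (word_value G t))), J)"
  using reduce_run[OF assms] assms(2) by (auto intro!: reduce_eqI simp: halted_def)

text \<open>Unbounded search is allowed only if the machine stops on every list of numbers. The part after the
  first number that codes no letter is never touched.\<close>

lemma split_at_foreign_letter:
  fixes c :: "'g \<Rightarrow> nat"
  obtains t J where "l = map c t @ J" and "t \<in> lists A" and "J = [] \<or> hd J \<notin> c ` A"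
proof -
  have "\<exists>t J. l = map c t @ J \<and> t \<in> lists A \<and> (J = [] \<or> hd J \<notin> c ` A)"
  proof (induction l)
    case (Cons b l)
    show ?case
    proof (cases "b \<in> c ` A")
      case True
      then obtain a where a: "a \<in> A" "b = c a" by auto
      obtain t J where "l = map c t @ J" "t \<in> lists A" "J = [] \<or> hd J \<notin> c ` A"
        using Cons.IH by blast
      then show ?thesis using a by (intro exI[of _ "a # t"] exI[of _ J]) simp
    next
      case False
      then show ?thesis by (intro exI[of _ "[]"] exI[of _ "b # l"]) simp
    qed
  qed simp
  then show thesis using that by blast
qed

lemma reduce_halts:
  assumes "inj_on c A"
  shows "\<exists>k. halted c A ((reduce_step c A rules ^^ k) ([], l))"
proof -
  obtain t J where *: "l = map c t @ J" "t \<in> lists A" "J = [] \<or> hd J \<notin> c ` A"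
    by (rule split_at_foreign_letter)
  then obtain k where "(reduce_step c A rules ^^ k) ([], l) = (map c (rev (nf (word_value G t))), J)"
    using reduce_run[OF assms] by blast
  then show ?thesis using *(3) by (intro exI[of _ k]) (simp add: halted_def)
qed

text \<open>The label of an edge is read off from the stack with \<open>nf g\<close>. A tree edge that lengthens the normal
  form admits no rule and is covered by the default value; only a tree edge that shortens it needs a
  test of its own.\<close>

definition coded_label :: "('g \<Rightarrow> nat) \<Rightarrow> nat list \<Rightarrow> 'g \<Rightarrow> nat list" where
  "coded_label c s a = (if s \<noteq> [] \<and> hd s = c (inv a) then [c a]
     else case matching_rule c rules (c a # s) of None \<Rightarrow> [c a] | Some r \<Rightarrow> map c (detour r))"

lemma coded_label_eq:
  assumes c: "inj_on c A" and g: "g \<in> carrier G" and a: "a \<in> A"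
  shows "coded_label c (map c (rev (nf g))) a = map c (flow_label g a)"
proof -
  have "matching_rule c rules (c a # map c (rev (nf g))) = first_rule (nf g @ [a])"
    using matching_rule_eq[OF c, of "nf g @ [a]"] nf_lists[OF g] a by simp
  moreover have "map c (rev (nf g)) \<noteq> [] \<and> hd (map c (rev (nf g))) = c (inv a)
      \<longleftrightarrow> nf g \<noteq> [] \<and> last (nf g) = inv a"
  proof (cases "nf g" rule: rev_cases)
    case (snoc y b)
    then have "b \<in> A" using nf_lists[OF g] by simp
    then show ?thesis using snoc inj_on_eq_iff[OF c _ inv_letter[OF a]] by simp
  qed simp
  ultimately show ?thesis
    using tree_edge_iff[OF g a] first_rule_None_iff[OF nf(1)[OF g] a]
    by (auto simp: coded_label_def flow_label_def split: option.split)
qed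

lemma computable_coded_label:
  assumes "computable_list n f"
  shows "computable_list n (\<lambda>xs. coded_label c (f xs) a)"
proof -
  note s = computable_list_Cons[OF computable_const assms]
  have "computable n (\<lambda>xs. case find (\<lambda>r. prefix (map c (rev (fst r))) (c a # f xs)) rules of
      None \<Rightarrow> list_encode [c a] | Some r \<Rightarrow> list_encode (map c (detour r)))"
    by (rule computable_case_find) (rule decidable_prefix[OF s] computable_const)+
  then have "computable_list n (\<lambda>xs. case matching_rule c rules (c a # f xs) of
      None \<Rightarrow> [c a] | Some r \<Rightarrow> map c (detour r))"
    unfolding computable_list_def matching_rule_def
    by (rule computable_cong) (simp split: option.split)
  then show ?thesis
    unfolding coded_label_def
    by (rule computable_list_if[OF decidable_head_eq[OF assms computable_const] computable_list_const])
qed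

text \<open>A triple is tested by running the machine on the word: it must read the whole input, and the label
  read off from its stack must be the given one. A test for each of the finitely many letters \<open>a\<close>
  avoids decoding the middle component.\<close>

lemma recursive_flow_graph: "recursive_word_set A (flow_graph G A flow)"
proof -
  obtain c :: "'g \<Rightarrow> nat" where c: "inj_on c A"
    using finite_imp_inj_to_nat_seg[OF finite_letters] by blast
  let ?red = "\<lambda>xs. reduce c A rules (list_decode (xs ! 0))"
  let ?P = "\<lambda>xs. \<exists>a\<in>A. (xs ! 1 = c a \<and> snd (?red xs) = [])
      \<and> list_decode (xs ! 2) = coded_label c (fst (?red xs)) a"
  let ?code = "\<lambda>(w, a, v). [list_encode (map c w), c a, list_encode (map c v)]"
  have "computable_list 3 (\<lambda>xs. list_decode (xs ! 0))"
    by (simp add: computable_list_decode computable_nth)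
  note red = computable_reduce[OF finite_letters reduce_halts[OF c] this]
  have "decidable 3 ?P"
    by (intro decidable_Bex_finite[OF finite_letters] decidable_conj decidable_list_eq decidable_eq
        computable_const computable_list_const computable_nth computable_list_decode
        computable_coded_label red) simp_all
  then have "recursive_set 3 {xs. length xs = 3 \<and> ?P xs}"
    by (rule recursive_set_if_decidable)
  moreover have "{xs. length xs = 3 \<and> ?P xs} = ?code ` flow_graph G A flow"
  proof (intro equalityI subsetI)
    fix xs assume "xs \<in> {xs. length xs = 3 \<and> ?P xs}"
    then obtain a where len: "length xs = 3" and a: "a \<in> A" "xs ! 1 = c a" "snd (?red xs) = []"
        and lab: "list_decode (xs ! 2) = coded_label c (fst (?red xs)) a" by blast
    obtain t J where t: "list_decode (xs ! 0) = map c t @ J" "t \<in> lists A" "J = [] \<or> hd J \<notin> c ` A"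
      by (rule split_at_foreign_letter)
    then have red: "?red xs = (map c (rev (nf (word_value G t))), J)"
      using reduce_eq[OF c] by simp
    then have "J = []" using a(3) by simp
    have "xs ! 0 = list_encode (map c t)"
      using t(1) \<open>J = []\<close> list_decode_inverse[of "xs ! 0"] by simp
    moreover have "xs ! 2 = list_encode (map c (flow_label (word_value G t) a))"
      using lab red coded_label_eq[OF c value_closed[OF t(2)] a(1)] list_decode_inverse[of "xs ! 2"] by simp
    moreover have "xs = [xs ! 0, xs ! 1, xs ! 2]"
      using len by (auto simp: numeral_3_eq_3 numeral_2_eq_2 length_Suc_conv)
    ultimately have "xs = ?code (t, a, flow_label (word_value G t) a)"
      using a(2) by simp
    moreover have "(t, a, flow_label (word_value G t) a) \<in> flow_graph G A flow"
      unfolding flow_graph_flow using t(2) a(1) by blast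
    ultimately show "xs \<in> ?code ` flow_graph G A flow" by (rule image_eqI)
  next
    fix xs assume "xs \<in> ?code ` flow_graph G A flow"
    then obtain w a where *: "w \<in> lists A" "a \<in> A"
        "xs = ?code (w, a, flow_label (word_value G w) a)"
      unfolding flow_graph_flow by blast
    then have "?red xs = (map c (rev (nf (word_value G w))), [])"
      using reduce_eq[OF c, of "[]" w] by simp
    then show "xs \<in> {xs. length xs = 3 \<and> ?P xs}"
      using * coded_label_eq[OF c value_closed[OF *(1)] *(2)] by auto
  qed
  moreover have "flow_graph G A flow \<subseteq> lists A \<times> A \<times> lists A"
    unfolding flow_graph_flow using flow_label_lists[OF value_closed] by blast
  ultimately show ?thesis
    unfolding recursive_word_set_def using c by auto
qed

theorem algorithmically_stackable: "algorithmically_stackable G"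
  unfolding algorithmically_stackable_def
  using finite_letters generating_letters one_not_letter maximal_tree_nf_tree flow_function_flow
    bounded_flow_flow recursive_flow_graph by blast

end

section \<open>From an abstract alphabet to a symmetric generating set\<close>

locale complete_presentation = group G for G :: "('g, 'm) monoid_scheme" (structure) +
  fixes A :: "'b set" and R :: "('b list \<times> 'b list) set" and \<phi> :: "'b list set \<Rightarrow> 'g"
  assumes finite_alphabet: "finite A"
    and finite_rules: "finite R"
    and rules_lists: "R \<subseteq> lists A \<times> lists A"
    and iso: "\<phi> \<in> iso (presented_monoid A R) G"
    and unique_irreducible:
      "g \<in> carrier G \<Longrightarrow> \<exists>!w. irreducible_word A R w \<and> \<phi> (word_class A R w) = g"
    and terminating: "wf ((rewrite_step A R)\<inverse>)"
begin

definition val :: "'b list \<Rightarrow> 'g" where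
  "val w = \<phi> (word_class A R w)"

lemma class_in_carrier: "w \<in> lists A \<Longrightarrow> word_class A R w \<in> carrier (presented_monoid A R)"
  by (simp add: presented_monoid_def word_class_def quotientI)

lemma hom: "\<phi> \<in> hom (presented_monoid A R) G"
  using iso by (simp add: iso_def)

lemma val_closed: "w \<in> lists A \<Longrightarrow> val w \<in> carrier G"
  unfolding val_def by (rule hom_in_carrier[OF hom class_in_carrier])

lemma val_append: "x \<in> lists A \<Longrightarrow> y \<in> lists A \<Longrightarrow> val (x @ y) = val x \<otimes> val y"
  unfolding val_def
  using hom_mult[OF hom class_in_carrier class_in_carrier, of x y]
  by (simp add: presented_monoid_mult[OF rules_lists])

lemma val_Nil [simp]: "val [] = \<one>"
proof -
  have "val ([] @ []) = val [] \<otimes> val []" by (rule val_append) simp_all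
  from this[unfolded append_Nil, symmetric] show ?thesis
    using l_cancel_one[of "val []" "val []"] val_closed[of "[]"] by blast
qed

lemma val_rule:
  assumes "(u, v) \<in> R"
  shows "val u = val v"
proof -
  have "(u, v) \<in> monoid_congruence A R" by (rule monoid_congruence.rule[OF assms])
  then show ?thesis
    using equiv_class_eq[OF equiv_monoid_congruence[OF rules_lists]] by (simp add: val_def word_class_def)
qed

lemma step_val:
  assumes "(w, w') \<in> rewrite_step A R"
  shows "val w' = val w"
proof -
  obtain x u v y where *: "w = x @ u @ y" "w' = x @ v @ y" "x \<in> lists A" "y \<in> lists A" "(u, v) \<in> R"
    using assms by (auto simp: rewrite_step_def)
  moreover have "u \<in> lists A" "v \<in> lists A" using *(5) rules_lists by auto
  ultimately show ?thesis
    using val_rule[OF *(5)] by (simp add: val_append)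
qed

sublocale normal_forms A R val "carrier G"
  by unfold_locales
    (fact rules_lists terminating val_closed step_val unique_irreducible[folded val_def])+

text \<open>Only irreducible letters occur in irreducible words, and they stand for pairwise different
  nontrivial elements.\<close>

definition letters :: "'b set" where
  "letters = {a \<in> A. irreducible [a]}"

definition elt :: "'b \<Rightarrow> 'g" where
  "elt a = val [a]"

lemma letters_subset: "letters \<subseteq> A"
  by (auto simp: letters_def)

lemma lists_letters: "w \<in> lists letters \<Longrightarrow> w \<in> lists A"
  by (rule subsetD[OF lists_mono[OF letters_subset]])

lemma irreducible_lists_letters:
  assumes "irreducible w"
  shows "w \<in> lists letters"
proof (rule in_listsI, rule ballI)
  fix a assume "a \<in> set w"
  then obtain x y where "w = x @ a # y" using split_list by fast
  then have "irreducible [a]" using irreducible_factor[of A R x "[a]" y] assms by simp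
  moreover from this have "a \<in> A" using irreducible_lists[of "[a]"] by simp
  ultimately show "a \<in> letters" by (simp add: letters_def)
qed

lemma nf_elt: "a \<in> letters \<Longrightarrow> nf (elt a) = [a]"
  by (rule nf_eqI) (simp_all add: letters_def elt_def)

lemma elt_inj: "inj_on elt letters"
proof (rule inj_onI)
  fix a b assume "a \<in> letters" "b \<in> letters" "elt a = elt b"
  then have "[a] = [b]" using nf_elt by metis
  then show "a = b" by simp
qed

lemma elt_closed: "a \<in> letters \<Longrightarrow> elt a \<in> carrier G"
  using letters_subset unfolding elt_def by (intro val_closed) auto

lemma elt_not_one:
  assumes "a \<in> letters"
  shows "elt a \<noteq> \<one>"
proof
  assume "elt a = \<one>"
  moreover have "nf \<one> = []"
    by (rule nf_eqI[OF terminating_Nil_irreducible[OF rules_lists terminating] val_Nil])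
  ultimately show False using nf_elt[OF assms] by simp
qed

lemma word_value_elt: "w \<in> lists A \<Longrightarrow> word_value G (map elt w) = val w"
proof (induction w)
  case (Cons a w)
  then have "val ([a] @ w) = val [a] \<otimes> val w" by (intro val_append) simp_all
  then show ?case using Cons by (simp add: elt_def)
qed simp

definition gens :: "'g set" where
  "gens = elt ` letters \<union> (\<lambda>g. inv g) ` elt ` letters"

definition normal_word :: "'g \<Rightarrow> 'g list" where
  "normal_word g = map elt (nf g)"

text \<open>A right-hand side may contain reducible letters, which have no counterpart among the generators;
  its normal form does not. An inverse that is not among the letters rewrites to its normal form
  at once, so it never occurs in an irreducible word.\<close>

definition gen_rules :: "('g list \<times> 'g list) set" where
  "gen_rules = {(map elt u, normal_word (val u)) | u v. (u, v) \<in> R \<and> u \<in> lists letters}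
     \<union> {([b], normal_word b) | b. b \<in> gens - elt ` letters}"

lemma gens_closed: "b \<in> gens \<Longrightarrow> b \<in> carrier G"
  using elt_closed by (auto simp: gens_def)

lemma lists_gens: "w \<in> lists letters \<Longrightarrow> map elt w \<in> lists gens"
  by (induction w) (auto simp: gens_def)

lemma normal_word_lists: "g \<in> carrier G \<Longrightarrow> normal_word g \<in> lists gens"
  unfolding normal_word_def by (intro lists_gens irreducible_lists_letters nf)

lemma normal_word_value: "g \<in> carrier G \<Longrightarrow> word_value G (normal_word g) = g"
  by (simp add: normal_word_def word_value_elt nf_lists nf)

lemma finite_gen_rules: "finite gen_rules"
proof -
  have "finite gens"
    using finite_subset[OF letters_subset finite_alphabet] by (simp add: gens_def)
  then have "finite ((\<lambda>(u, v). (map elt u, normal_word (val u))) ` R \<union> (\<lambda>b. ([b], normal_word b)) ` gens)"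
    using finite_rules by simp
  moreover have "gen_rules
      \<subseteq> (\<lambda>(u, v). (map elt u, normal_word (val u))) ` R \<union> (\<lambda>b. ([b], normal_word b)) ` gens"
    unfolding gen_rules_def by force
  ultimately show ?thesis by (rule finite_subset[rotated])
qed

lemma gen_rules_cases:
  assumes "(U, V) \<in> gen_rules"
  obtains (positive) u v where "(u, v) \<in> R" and "u \<in> lists letters" and "U = map elt u"
      and "V = normal_word (val u)"
    | (inverse) b where "b \<in> gens" and "b \<notin> elt ` letters" and "U = [b]" and "V = normal_word b"
  using assms unfolding gen_rules_def by blast

lemma gen_rules_lists: "gen_rules \<subseteq> lists gens \<times> lists gens"
proof (rule subrelI)
  fix U V assume "(U, V) \<in> gen_rules"
  then show "(U, V) \<in> lists gens \<times> lists gens"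
    by (cases rule: gen_rules_cases)
      (simp_all add: lists_gens normal_word_lists val_closed lists_letters gens_closed)
qed

lemma gen_rules_sound:
  assumes "(U, V) \<in> gen_rules"
  shows "word_value G U = word_value G V"
  using assms
  by (cases rule: gen_rules_cases)
    (simp_all add: word_value_elt normal_word_value val_closed lists_letters gens_closed)

definition pull_back :: "'g list \<Rightarrow> 'b list" where
  "pull_back w = concat (map nf w)"

lemma pull_back_append [simp]: "pull_back (x @ y) = pull_back x @ pull_back y"
  by (simp add: pull_back_def)

lemma pull_back_lists: "w \<in> lists gens \<Longrightarrow> pull_back w \<in> lists A"
  by (induction w) (simp_all add: pull_back_def nf_lists gens_closed)

lemma pull_back_elt: "u \<in> lists letters \<Longrightarrow> pull_back (map elt u) = u"
  by (induction u) (simp_all add: pull_back_def nf_elt)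

lemma pull_back_normal_word: "g \<in> carrier G \<Longrightarrow> pull_back (normal_word g) = nf g"
  unfolding normal_word_def by (intro pull_back_elt irreducible_lists_letters nf)

text \<open>Termination is measured on the words over the alphabet that arise by replacing every generator
  with its normal form. A rule of the first kind becomes a nonempty rewriting of the words over the alphabet, since
  its left-hand side is reducible there. A rule of the second kind does not change the word over the
  alphabet, but removes an inverse letter.\<close>

lemma gen_rules_terminating: "wf ((rewrite_step gens gen_rules)\<inverse>)"
proof -
  define count where "count w = length (filter (\<lambda>b. b \<notin> elt ` letters) w)" for w :: "'g list"
  have count_append [simp]: "count (x @ y) = count x + count y" for x y
    by (simp add: count_def)
  have "wf ((step\<^sup>+)\<inverse>)" using wf_trancl[OF terminating] by (simp add: trancl_converse)
  then have "wf (inv_image ((step\<^sup>+)\<inverse> <*lex*> less_than) (\<lambda>w. (pull_back w, count w)))"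
    by (intro wf_inv_image wf_lex_prod wf_less_than)
  moreover have "(rewrite_step gens gen_rules)\<inverse>
      \<subseteq> inv_image ((step\<^sup>+)\<inverse> <*lex*> less_than) (\<lambda>w. (pull_back w, count w))"
  proof (rule subrelI)
    fix w' w assume "(w', w) \<in> (rewrite_step gens gen_rules)\<inverse>"
    then obtain x U V y where *: "w = x @ U @ y" "w' = x @ V @ y" "x \<in> lists gens" "y \<in> lists gens"
        "(U, V) \<in> gen_rules"
      unfolding rewrite_step_def by blast
    from *(5) show "(w', w) \<in> inv_image ((step\<^sup>+)\<inverse> <*lex*> less_than) (\<lambda>w. (pull_back w, count w))"
    proof (cases rule: gen_rules_cases)
      case (positive u v)
      have u: "u \<in> lists A" "v \<in> lists A" using positive(1) rules_lists by auto
      have "(u, v) \<in> step" using rewrite_step_rule[OF positive(1), of "[]" A "[]"] by simp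
      then have "(u, nf (val u)) \<in> step\<^sup>+"
        using rewrites_to_nf[OF u(2)] val_rule[OF positive(1)] by (simp add: rtrancl_into_trancl2)
      then have "(pull_back x @ u @ pull_back y, pull_back x @ nf (val u) @ pull_back y) \<in> step\<^sup>+"
        by (rule rewrite_steps_context(2)[OF pull_back_lists[OF *(3)] pull_back_lists[OF *(4)]])
      moreover have "pull_back U = u" "pull_back V = nf (val u)"
        using positive(2-4) u by (simp_all add: pull_back_elt pull_back_normal_word val_closed)
      ultimately have "(pull_back w, pull_back w') \<in> step\<^sup>+"
        using *(1,2) by simp
      then show ?thesis by simp
    next
      case (inverse b)
      have "pull_back U = pull_back V"
        using inverse by (simp add: pull_back_normal_word gens_closed) (simp add: pull_back_def)
      then have "pull_back w = pull_back w'"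
        using *(1,2) by simp
      moreover have "count V = 0"
        using irreducible_lists_letters[OF nf(1)[OF gens_closed[OF inverse(1)]]] inverse(4)
        by (auto simp: count_def normal_word_def filter_empty_conv)
      moreover have "count U = 1" using inverse by (simp add: count_def)
      ultimately show ?thesis using *(1,2) by simp
    qed
  qed
  ultimately show ?thesis by (rule wf_subset)
qed

lemma gen_irreducible_iff:
  "irreducible_word gens gen_rules w \<longleftrightarrow> (\<exists>u. irreducible u \<and> w = map elt u)"
proof
  assume irr: "irreducible_word gens gen_rules w"
  have no_rule: False if "w = x @ U @ y" "(U, V) \<in> gen_rules" for x U V y
  proof -
    have "x \<in> lists gens" "y \<in> lists gens" using irr that(1) by (simp_all add: irreducible_word_def)
    then show False
      using rewrite_step_rule[OF that(2), of x gens y] irr that(1) by (simp add: irreducible_word_def)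
  qed
  have "b \<in> elt ` letters" if "b \<in> set w" for b
  proof (rule ccontr)
    assume "b \<notin> elt ` letters"
    moreover have "b \<in> gens" using irr that by (auto simp: irreducible_word_def)
    ultimately have "([b], normal_word b) \<in> gen_rules" by (simp add: gen_rules_def)
    moreover from split_list[OF that] obtain x y where "w = x @ b # y" by blast
    ultimately show False using no_rule[of x "[b]" y] by auto
  qed
  then have "w \<in> lists (elt ` letters)" by auto
  then obtain u where u: "w = map elt u" "u \<in> lists letters"
    unfolding lists_image by blast
  have "irreducible u"
    unfolding irreducible_word_def
  proof (intro conjI notI)
    assume "\<exists>u'. (u, u') \<in> step"
    then obtain x p q y where *: "u = x @ p @ y" "(p, q) \<in> R" by (auto simp: rewrite_step_def)
    then have "(map elt p, normal_word (val p)) \<in> gen_rules"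
      using u(2) unfolding gen_rules_def by auto
    then show False using no_rule[of "map elt x" "map elt p" "map elt y"] u(1) *(1) by auto
  qed (rule lists_letters[OF u(2)])
  then show "\<exists>u. irreducible u \<and> w = map elt u" using u(1) by blast
next
  assume "\<exists>u. irreducible u \<and> w = map elt u"
  then obtain u where u: "irreducible u" "w = map elt u" by blast
  have ul: "u \<in> lists letters" by (rule irreducible_lists_letters[OF u(1)])
  show "irreducible_word gens gen_rules w"
    unfolding irreducible_word_def
  proof (intro conjI notI)
    show "w \<in> lists gens" using lists_gens[OF ul] u(2) by simp
    assume "\<exists>w'. (w, w') \<in> rewrite_step gens gen_rules"
    then obtain x U V y where *: "w = x @ U @ y" "(U, V) \<in> gen_rules"
      unfolding rewrite_step_def by blast
    define u1 where "u1 = take (length x) u"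
    define u2 where "u2 = take (length U) (drop (length x) u)"
    define u3 where "u3 = drop (length U) (drop (length x) u)"
    have split: "u = u1 @ u2 @ u3" "U = map elt u2"
    proof -
      show "u = u1 @ u2 @ u3" by (simp only: u1_def u2_def u3_def append_take_drop_id)
      have "map elt u2 = take (length U) (drop (length x) (map elt u))"
        by (simp add: u2_def take_map drop_map)
      also have "\<dots> = U" using *(1) u(2) by simp
      finally show "U = map elt u2" by simp
    qed
    have lists: "u1 \<in> lists letters" "u2 \<in> lists letters" "u3 \<in> lists letters"
      using ul split(1) by simp_all
    from *(2) show False
    proof (cases rule: gen_rules_cases)
      case (positive p q)
      have "inj_on elt (set u2 \<union> set p)"
        using lists(2) positive(2) by (intro inj_on_subset[OF elt_inj]) auto
      moreover have "map elt u2 = map elt p" using positive(3) split(2) by simp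
      ultimately have "u2 = p" using inj_on_map_eq_map[of elt u2 p] by simp
      then have "(u, u1 @ q @ u3) \<in> step"
        unfolding split(1)
        using rewrite_step_rule[OF positive(1) lists_letters[OF lists(1)] lists_letters[OF lists(3)]] by simp
      then show False using u(1) by (auto simp: irreducible_word_def)
    next
      case (inverse b)
      then show False using split(2) lists(2) by (cases u2) auto
    qed
  qed
qed

lemma gen_unique_irreducible:
  assumes "g \<in> carrier G"
  shows "\<exists>!w. irreducible_word gens gen_rules w \<and> word_value G w = g"
proof (rule ex1I)
  show "irreducible_word gens gen_rules (normal_word g) \<and> word_value G (normal_word g) = g"
    using gen_irreducible_iff nf(1)[OF assms] normal_word_value[OF assms]
    by (auto simp: normal_word_def)
next
  fix w assume w: "irreducible_word gens gen_rules w \<and> word_value G w = g"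
  then obtain u where u: "irreducible u" "w = map elt u" using gen_irreducible_iff by blast
  then have "val u = g" using w word_value_elt[OF irreducible_lists[OF u(1)]] by simp
  then show "w = normal_word g" using nf_eqI[OF u(1)] u(2) by (simp add: normal_word_def)
qed

lemma algorithmically_stackable: "algorithmically_stackable G"
proof -
  obtain rules where rules: "set rules = gen_rules"
    using finite_list[OF finite_gen_rules] by blast
  have "group_rewriting G gens rules"
  proof (unfold_locales, unfold rules)
    show "finite gens"
      using finite_subset[OF letters_subset finite_alphabet] by (simp add: gens_def)
    show "gens \<subseteq> carrier G" using gens_closed by blast
    show "inv b \<in> gens" if "b \<in> gens" for b
      using that elt_closed by (auto simp: gens_def)
    show "\<one> \<notin> gens"
    proof
      assume "\<one> \<in> gens"
      then obtain a where "a \<in> letters" "\<one> = elt a \<or> \<one> = inv (elt a)"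
        by (auto simp: gens_def)
      moreover from this have "elt a = \<one>"
        by (metis elt_closed inv_eq_1_iff)
      ultimately show False using elt_not_one[of a] by simp
    qed
  qed (fact gen_rules_lists gen_rules_sound gen_rules_terminating gen_unique_irreducible)+
  then show ?thesis by (rule group_rewriting.algorithmically_stackable)
qed

end

theorem theorem4p1:
  fixes G :: "('g, 'm) monoid_scheme"
    and A :: "'b set"
    and R :: "('b list \<times> 'b list) set"
  assumes "group G"
    and "finite_complete_rewriting_system G A R"
  shows "algorithmically_stackable G"
proof -
  interpret group G by fact
  obtain \<phi> where \<phi>: "\<phi> \<in> iso (presented_monoid A R) G"
      "\<forall>g \<in> carrier G. \<exists>!w. irreducible_word A R w \<and> \<phi> (word_class A R w) = g"
    using assms(2)[unfolded finite_complete_rewriting_system_def] by (elim conjE bexE)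
  have "wf (((rewrite_step A R)\<^sup>+)\<inverse>)"
    using assms(2) by (simp add: finite_complete_rewriting_system_def)
  then have wf: "wf ((rewrite_step A R)\<inverse>)"
    by (rule wf_subset) auto
  have fin: "finite A" "finite R" "R \<subseteq> lists A \<times> lists A"
    using assms(2) by (simp_all add: finite_complete_rewriting_system_def)
  have "complete_presentation G A R \<phi>"
    by unfold_locales (fact fin wf \<phi>(1) bspec[OF \<phi>(2)])+
  then show ?thesis by (rule complete_presentation.algorithmically_stackable)
qed

end
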